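(* One has $\mathcal{P}_2=\mathcal{H}_2=\mathcal{O}_2=\mathcal{V}_2\neq\mathcal{B}_2$.
   Context: $\mathbb{C}^k$ is regarded as a commutative unital algebra under coordinatewise multiplication $v\cdot w=(v_1w_1,\dots,v_kw_k)$ with unit $e=(1,\dots,1)$. A Banach algebra norm on $\mathbb{C}^k$ is a norm with $\|v\cdot w\|\le\|v\|\,\|w\|$ for all $v,w$ and $\|e\|=1$. The ball of a norm is its closed unit ball $\{v\in\mathbb{C}^k:\|v\|\le1\}$. $\mathcal{B}_k$ is the set of all balls of Banach algebra norms on $\mathbb{C}^k$. $\mathcal{V}_k$ is the set of all balls of Banach algebra norms on $\mathbb{C}^k$ satisfying von Neumann's inequality: $\|p(a)\|\le\sup\{|p(z)|:|z|\le1\}$ for every $a$ with $\|a\|\le1$ and every polynomial $p$ in one variable. $\mathcal{O}_k$ is the set of all balls of Banach algebra norms on $\mathbb{C}^k$ such that the resulting Banach algebra has a unital isometric representation as an algebra of operators on a Hilbert space. $\mathcal{H}_k$ is the set of all balls of Banach algebra norms on $\mathbb{C}^k$ satisfying the multi-variable von Neumann inequality: for every $n$, all $a_1,\dots,a_n$ in the closed unit ball and every polynomial $p$ in $n$ variables, $\|p(a_1,\dots,a_n)\|\le\sup\{|p(z_1,\dots,z_n)|:|z_i|\le1,\ 1\le i\le n\}$. $\mathcal{P}_k$ is the set of all Pick bodies $\mathcal{P}(\alpha_1,\dots,\alpha_k)\subseteq\mathbb{C}^k$, where $\alpha_1,\dots,\alpha_k$ are distinct points of the closed unit disk, and $\mathcal{P}(\alpha_1,\dots,\alpha_k)$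 is the set of all $(w_1,\dots,w_k)$ such that for every $\epsilon>0$ there is $f$ in the disk algebra $A(\mathbb{D})$ (functions continuous on the closed unit disk and analytic in its interior, with supremum norm) with $\|f\|_\infty\le1+\epsilon$ and $f(\alpha_i)=w_i$ for all $i$. *)

theory Defs
  imports
    "HOL-Analysis.Analysis"
    "HOL-Computational_Algebra.Polynomial"
    "HOL-Library.Poly_Mapping"
    "HOL-Algebra.Module"
begin

section \<open>Banach algebra norms on the algebra of complex k-tuples\<close>

text \<open>The type \<open>complex^'k\<close> carries the coordinatewise ring structure of the library (with unit
  \<open>1 = vec 1\<close>); \<open>*s\<close> is multiplication by complex scalars, and \<open>vec\<close> is the unital embedding of
  the scalars.\<close>

definition complex_norm :: "(complex^'k \<Rightarrow> real) \<Rightarrow> bool" where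
  "complex_norm N \<longleftrightarrow>
     (\<forall>v. N v \<ge> 0) \<and>
     (\<forall>v. N v = 0 \<longleftrightarrow> v = 0) \<and>
     (\<forall>c v. N (c *s v) = cmod c * N v) \<and>
     (\<forall>v w. N (v + w) \<le> N v + N w)"

definition banach_algebra_norm :: "(complex^'k \<Rightarrow> real) \<Rightarrow> bool" where
  "banach_algebra_norm N \<longleftrightarrow>
     complex_norm N \<and> (\<forall>v w. N (v * w) \<le> N v * N w) \<and> N 1 = 1"

definition unit_ball :: "(complex^'k \<Rightarrow> real) \<Rightarrow> (complex^'k) set" where
  "unit_ball N = {v. N v \<le> 1}"

definition B_balls :: "(complex^'k) set set" where
  "B_balls = {unit_ball N | N. banach_algebra_norm N}"


section \<open>Von Neumann's inequality\<close>

definition von_neumann :: "(complex^'k \<Rightarrow> real) \<Rightarrow> bool" where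
  "von_neumann N \<longleftrightarrow>
     (\<forall>a (p :: complex poly). N a \<le> 1 \<longrightarrow>
        N (poly (map_poly vec p) a) \<le> (SUP z\<in>{z. cmod z \<le> 1}. cmod (poly p z)))"

definition V_balls :: "(complex^'k) set set" where
  "V_balls = {unit_ball N | N. banach_algebra_norm N \<and> von_neumann N}"

text \<open>A multivariate polynomial maps each monomial (a finitely supported family of exponents,
  indexed by the variables) to its coefficient, all but finitely many being zero. The argument \<open>h\<close>
  of \<open>mpoly_eval\<close> embeds the coefficients into the ring in which the polynomial is evaluated.\<close>

type_synonym mpoly = "(nat \<Rightarrow>\<^sub>0 nat) \<Rightarrow>\<^sub>0 complex"

definition mpoly_eval :: "(complex \<Rightarrow> 'r::comm_ring_1) \<Rightarrow> mpoly \<Rightarrow> (nat \<Rightarrow> 'r) \<Rightarrow> 'r" where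
  "mpoly_eval h p a =
     (\<Sum>m\<in>Poly_Mapping.keys p. h (Poly_Mapping.lookup p m) * (\<Prod>i\<in>Poly_Mapping.keys m. a i ^ Poly_Mapping.lookup m i))"

definition mpoly_in :: "nat \<Rightarrow> mpoly \<Rightarrow> bool" where
  "mpoly_in n p \<longleftrightarrow> (\<forall>m\<in>Poly_Mapping.keys p. Poly_Mapping.keys m \<subseteq> {..<n})"

definition multi_von_neumann :: "(complex^'k \<Rightarrow> real) \<Rightarrow> bool" where
  "multi_von_neumann N \<longleftrightarrow>
     (\<forall>n (a :: nat \<Rightarrow> complex^'k) p. (\<forall>i<n. N (a i) \<le> 1) \<and> mpoly_in n p \<longrightarrow>
        N (mpoly_eval vec p a)
          \<le> (SUP z\<in>{z. \<forall>i<n. cmod (z i) \<le> 1}. cmod (mpoly_eval (\<lambda>c. c) p z)))"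

definition H_balls :: "(complex^'k) set set" where
  "H_balls = {unit_ball N | N. banach_algebra_norm N \<and> multi_von_neumann N}"


section \<open>Operator algebra norms\<close>

definition complex_field :: "complex ring" where
  "complex_field = \<lparr>carrier = UNIV, mult = (*), one = 1, zero = 0, add = (+)\<rparr>"

text \<open>Hilbert spaces are structures with a carrier set, rather than types of some class, since the
  existence of a Hilbert space has to be expressed inside a formula. A vector space is a module
  over the complex field; the fields \<open>mult\<close> and \<open>one\<close> inherited by module records play no role.\<close>

record 'h inner_product_space = "(complex, 'h) module" +
  cinner :: "'h \<Rightarrow> 'h \<Rightarrow> complex"

definition hnorm :: "('h, 'm) inner_product_space_scheme \<Rightarrow> 'h \<Rightarrow> real" where
  "hnorm E x = sqrt (Re (cinner E x x))"

definition hdist :: "('h, 'm) inner_product_space_scheme \<Rightarrow> 'h \<Rightarrow> 'h \<Rightarrow> real" where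
  "hdist E x y = hnorm E (x \<ominus>\<^bsub>E\<^esub> y)"

locale complex_hilbert_space = module complex_field E for E (structure) +
  assumes cinner_commute:
      "\<lbrakk>x \<in> carrier E; y \<in> carrier E\<rbrakk> \<Longrightarrow> cinner E x y = cnj (cinner E y x)"
    and cinner_add_left:
      "\<lbrakk>x \<in> carrier E; y \<in> carrier E; z \<in> carrier E\<rbrakk> \<Longrightarrow>
        cinner E (x \<oplus>\<^bsub>E\<^esub> y) z = cinner E x z + cinner E y z"
    and cinner_smult_left:
      "\<lbrakk>x \<in> carrier E; y \<in> carrier E\<rbrakk> \<Longrightarrow> cinner E (c \<odot>\<^bsub>E\<^esub> x) y = c * cinner E x y"
    and cinner_pos:
      "\<lbrakk>x \<in> carrier E; x \<noteq> \<zero>\<^bsub>E\<^esub>\<rbrakk> \<Longrightarrow> Re (cinner E x x) > 0"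
    and complete: "Metric_space.mcomplete (carrier E) (hdist E)"

definition bounded_operator ::
    "('h, 'm) inner_product_space_scheme \<Rightarrow> ('h \<Rightarrow> 'h) \<Rightarrow> bool" where
  "bounded_operator E T \<longleftrightarrow>
     (\<forall>x\<in>carrier E. T x \<in> carrier E) \<and>
     (\<forall>x\<in>carrier E. \<forall>y\<in>carrier E. T (x \<oplus>\<^bsub>E\<^esub> y) = T x \<oplus>\<^bsub>E\<^esub> T y) \<and>
     (\<forall>c. \<forall>x\<in>carrier E. T (c \<odot>\<^bsub>E\<^esub> x) = c \<odot>\<^bsub>E\<^esub> T x) \<and>
     (\<exists>M. \<forall>x\<in>carrier E. hnorm E (T x) \<le> M * hnorm E x)"

definition operator_norm ::
    "('h, 'm) inner_product_space_scheme \<Rightarrow> ('h \<Rightarrow> 'h) \<Rightarrow> real" where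
  "operator_norm E T = (SUP x\<in>{x \<in> carrier E. hnorm E x \<le> 1}. hnorm E (T x))"

definition unital_isometric_representation ::
    "(complex^'k \<Rightarrow> real) \<Rightarrow> ('h, 'm) inner_product_space_scheme
      \<Rightarrow> (complex^'k \<Rightarrow> 'h \<Rightarrow> 'h) \<Rightarrow> bool" where
  "unital_isometric_representation N E \<pi> \<longleftrightarrow>
     (\<forall>v. bounded_operator E (\<pi> v)) \<and>
     (\<forall>v w. \<forall>x\<in>carrier E. \<pi> (v + w) x = \<pi> v x \<oplus>\<^bsub>E\<^esub> \<pi> w x) \<and>
     (\<forall>c v. \<forall>x\<in>carrier E. \<pi> (c *s v) x = c \<odot>\<^bsub>E\<^esub> \<pi> v x) \<and>
     (\<forall>v w. \<forall>x\<in>carrier E. \<pi> (v * w) x = \<pi> v (\<pi> w x)) \<and>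
     (\<forall>x\<in>carrier E. \<pi> 1 x = x) \<and>
     (\<forall>v. operator_norm E (\<pi> v) = N v)"

text \<open>HOL cannot quantify over types inside a formula, so the Hilbert space is taken with a carrier
  consisting of functions \<open>'i \<Rightarrow> complex\<close>, with arbitrary (not necessarily pointwise) operations.
  This loses no generality when \<open>'i\<close> is left arbitrary: a Hilbert space with orthonormal basis
  indexed by \<open>'i\<close> is isomorphic to the space of square summable functions on \<open>'i\<close>, whose elements
  are functions of this kind.\<close>

definition O_balls :: "'i itself \<Rightarrow> (complex^'k) set set" where
  "O_balls _ = {unit_ball N | N. banach_algebra_norm N \<and>
     (\<exists>(E :: ('i \<Rightarrow> complex) inner_product_space) \<pi>.
        complex_hilbert_space E \<and> unital_isometric_representation N E \<pi>)}"


section \<open>Pick bodies\<close>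

definition disk_algebra :: "(complex \<Rightarrow> complex) set" where
  "disk_algebra = {f. continuous_on (cball 0 1) f \<and> f holomorphic_on ball 0 1}"

definition disk_norm :: "(complex \<Rightarrow> complex) \<Rightarrow> real" where
  "disk_norm f = (SUP z\<in>cball 0 1. cmod (f z))"

definition pick_body :: "('k \<Rightarrow> complex) \<Rightarrow> (complex^'k) set" where
  "pick_body \<alpha> = {w. \<forall>\<epsilon>>0. \<exists>f\<in>disk_algebra. disk_norm f \<le> 1 + \<epsilon> \<and> (\<forall>i. f (\<alpha> i) = w $ i)}"

definition P_balls :: "(complex^'k) set set" where
  "P_balls = {pick_body \<alpha> | \<alpha>. inj \<alpha> \<and> (\<forall>i. \<alpha> i \<in> cball 0 1)}"

end

theory Submission
  imports Defs "HOL-Complex_Analysis.Complex_Analysis"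
begin

text \<open>
  Write \<open>\<rho>(a,b) = |a - b| / |1 - cnj a b|\<close> for the pseudohyperbolic distance and, for
  \<open>0 < r \<le> 1\<close>, let \<open>D\<^sub>r\<close> be the set of pairs in the closed bidisc with
  \<open>|w\<^sub>1 - w\<^sub>2| \<le> r |1 - cnj w\<^sub>1 w\<^sub>2|\<close> (\<open>pseudohyperbolic_pairs r\<close>). Each of the four
  classes turns out to be the one-parameter family of all \<open>D\<^sub>r\<close>. The reason is the same every
  time: the disc automorphisms act on the ball coordinatewise, and an automorphism takes a pair of
  points of the open disc to \<open>(0, d)\<close> with \<open>|d| = \<rho>\<close>. So the ball is known as soon as one
  knows which multiples of the idempotent \<open>q = (0, 1)\<close> lie in it, and \<open>r = 1 / \<parallel>q\<parallel>\<close>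
  (\<open>unit_ball_eq_pseudohyperbolic_pairs\<close>).

  \<^item> Pick bodies: Schwarz--Pick says that the values of a contractive function at two points are
    no farther apart than the points, and a scaled automorphism attains every pair allowed by this.
    Points on the unit circle are at distance \<open>1\<close> from all others and give \<open>D\<^sub>1\<close>.

  \<^item> Von Neumann norms: polynomial approximations of an automorphism, applied to an element of the
    ball, show that the automorphism maps the ball to itself (\<open>von_neumann_Moebius\<close>).

  \<^item> Operator algebras: a representation splits the Hilbert space into the ranges of two
    complementary idempotents. Contractivity of \<open>v\<^sub>1 P + v\<^sub>2 Q\<close> is positivity of a Hermitian
    form in the two components, and its discriminant condition depends on \<open>v\<close> only through
    \<open>\<rho>(v\<^sub>1, v\<^sub>2)\<close> (\<open>representation_contraction_iff\<close>). Conversely, the matrices with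
    rows \<open>(v\<^sub>1, s (v\<^sub>2 - v\<^sub>1))\<close> and \<open>(0, v\<^sub>2)\<close> on the Hilbert space of pairs give an
    operator algebra in which \<open>q\<close> has norm \<open>sqrt (s\<^sup>2 + 1)\<close>; every \<open>r\<close> occurs. This also
    provides the norm whose ball is \<open>D\<^sub>r\<close>.

  \<^item> Multivariable von Neumann inequality: for \<open>r < 1\<close> the elements \<open>a\<^sub>1, \<dots>, a\<^sub>n\<close> of
    \<open>D\<^sub>r\<close> are the values at \<open>0\<close> and \<open>r\<close> of contractive functions \<open>f\<^sub>i\<close>. Then
    \<open>p(a\<^sub>1, \<dots>, a\<^sub>n)\<close> is the pair of values of \<open>p(f\<^sub>1, \<dots>, f\<^sub>n)\<close>, which is bounded by
    the supremum of \<open>|p|\<close>, and Schwarz--Pick applies. The ordinary inequality is the case of one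
    variable.

  Finally, \<open>|v\<^sub>1| + |v\<^sub>2 - v\<^sub>1|\<close> is a Banach algebra norm with \<open>\<parallel>q\<parallel> = 1\<close>. Its ball
  would have to be \<open>D\<^sub>1\<close>, the bidisc, but it does not contain \<open>(1, -1)\<close>.
\<close>

(* The symbol for vector components is also that of power series coefficients. *)
unbundle no Formal_Power_Series.fps_syntax

section \<open>Pseudohyperbolic geometry of the disc and Schwarz--Pick\<close>

definition pseudohyperbolic :: "complex \<Rightarrow> complex \<Rightarrow> real" where
  "pseudohyperbolic a b = cmod (a - b) / cmod (1 - cnj a * b)"

text \<open>Without a division the condition also makes sense for equal points of the unit circle, and it is
closed. For \<open>r < 1\<close> a pair with an entry on the circle must be constant; for \<open>r = 1\<close> the set
is the whole closed bidisc.\<close>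

definition pseudohyperbolic_pairs :: "real \<Rightarrow> (complex^2) set" where
  "pseudohyperbolic_pairs r = {w. cmod (w$1) \<le> 1 \<and> cmod (w$2) \<le> 1 \<and>
     cmod (w$1 - w$2) \<le> r * cmod (1 - cnj (w$1) * w$2)}"

text \<open>This identity is behind every comparison of \<open>|a - b|\<close> with \<open>|1 - cnj a b|\<close>: the sign of the
difference is that of \<open>(1 - |a|\<^sup>2) (1 - |b|\<^sup>2)\<close>. In the Hilbert space argument it turns a
discriminant into a pseudohyperbolic distance.\<close>

lemma pseudohyperbolic_identity:
  "(cmod (1 - cnj a * b))\<^sup>2 - (cmod (a - b))\<^sup>2 = (1 - (cmod a)\<^sup>2) * (1 - (cmod b)\<^sup>2)"
  unfolding cmod_power2 by (simp add: algebra_simps power2_eq_square)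

lemma cmod_one_minus_cnj_commute: "cmod (1 - cnj a * b) = cmod (1 - cnj b * a)"
proof -
  have "1 - cnj b * a = cnj (1 - cnj a * b)" by (simp add: mult.commute)
  then show ?thesis by (simp only: complex_mod_cnj)
qed

lemma cmod_diff_le_disc:
  assumes "cmod a \<le> 1" "cmod b \<le> 1"
  shows "cmod (a - b) \<le> cmod (1 - cnj a * b)"
proof -
  have "0 \<le> (1 - (cmod a)\<^sup>2) * (1 - (cmod b)\<^sup>2)"
    using assms by (simp add: power_le_one)
  then show ?thesis
    using pseudohyperbolic_identity[of a b] by - (rule power2_le_imp_le, linarith, simp)
qed

lemma cmod_diff_eq_circle:
  assumes "cmod a = 1 \<or> cmod b = 1"
  shows "cmod (a - b) = cmod (1 - cnj a * b)"
proof -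
  have "(cmod (a - b))\<^sup>2 = (cmod (1 - cnj a * b))\<^sup>2"
    using pseudohyperbolic_identity[of a b] assms by auto
  then show ?thesis by (simp add: power2_eq_iff_nonneg)
qed

lemma one_minus_cnj_nonzero:
  assumes "cmod a \<le> 1" "cmod b \<le> 1" "a \<noteq> b \<or> cmod a < 1"
  shows "1 - cnj a * b \<noteq> 0"
proof
  assume eq: "1 - cnj a * b = 0"
  then have "a = b" using cmod_diff_le_disc[of a b] assms by auto
  moreover have "cmod a * cmod b = 1"
    using eq by (metis complex_mod_cnj eq_iff_diff_eq_0 norm_mult norm_one)
  ultimately have "cmod a = 1" using power2_eq_1_iff[of "cmod a"] norm_ge_zero[of b]
    by (auto simp: power2_eq_square)
  then show False using assms \<open>a = b\<close> by auto
qed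

lemma disk_norm_le_iff:
  assumes "f \<in> disk_algebra"
  shows "disk_norm f \<le> K \<longleftrightarrow> (\<forall>z\<in>cball 0 1. cmod (f z) \<le> K)"
proof -
  have "compact ((\<lambda>z. cmod (f z)) ` cball 0 1)"
    using assms by (auto simp: disk_algebra_def intro!: compact_continuous_image continuous_intros)
  then have "bdd_above ((\<lambda>z. cmod (f z)) ` cball 0 1)"
    by (intro bounded_imp_bdd_above compact_imp_bounded)
  then show ?thesis unfolding disk_norm_def by (subst cSUP_le_iff) auto
qed

lemma disk_algebra_compose:
  assumes f: "f \<in> disk_algebra" and g: "g \<in> disk_algebra"
    and cb: "g ` cball 0 1 \<subseteq> cball 0 1" and b: "g ` ball 0 1 \<subseteq> ball 0 1"
  shows "f \<circ> g \<in> disk_algebra"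
  using assms holomorphic_on_compose_gen[of g "ball 0 1" f "ball 0 1"]
    continuous_on_compose[of "cball 0 1" g f] continuous_on_subset[OF _ cb, of f]
  by (simp add: disk_algebra_def)

lemma Moebius_function_disk_algebra:
  assumes "cmod a < 1"
  shows "Moebius_function 0 a \<in> disk_algebra"
    and "cmod z \<le> 1 \<Longrightarrow> cmod (Moebius_function 0 a z) \<le> 1"
proof -
  have nz: "1 - cnj a * z \<noteq> 0" if "cmod z \<le> 1" for z
    using one_minus_cnj_nonzero[of a z] assms that by auto
  have "continuous_on (cball 0 1) (\<lambda>z. (z - a) / (1 - cnj a * z))"
    using nz by (auto intro!: continuous_intros)
  moreover have "Moebius_function 0 a = (\<lambda>z. (z - a) / (1 - cnj a * z))"
    by (simp add: fun_eq_iff Moebius_function_simple)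
  ultimately show "Moebius_function 0 a \<in> disk_algebra"
    using Moebius_function_holomorphic[OF assms, of 0] by (simp add: disk_algebra_def)
  show "cmod (Moebius_function 0 a z) \<le> 1" if "cmod z \<le> 1"
    using cmod_diff_le_disc[of a z] assms that nz[OF that]
    by (simp add: Moebius_function_simple norm_divide norm_minus_commute)
qed

lemma Moebius_function_inverse:
  assumes "cmod a < 1" "cmod z \<le> 1"
  shows "Moebius_function 0 (-a) (Moebius_function 0 a z) = z"
proof -
  have nz: "1 - cnj a * z \<noteq> 0" using one_minus_cnj_nonzero[of a z] assms by auto
  have nz2: "1 - cnj a * a \<noteq> 0" using one_minus_cnj_nonzero[of a a] assms by auto
  have num: "(z - a) / (1 - cnj a * z) - - a = z * (1 - cnj a * a) / (1 - cnj a * z)"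
    using nz by (simp add: field_simps)
  have den: "1 - cnj (- a) * ((z - a) / (1 - cnj a * z)) = (1 - cnj a * a) / (1 - cnj a * z)"
    using nz by (simp add: field_simps)
  show ?thesis unfolding Moebius_function_simple num den using nz nz2 by simp
qed

text \<open>The Schwarz lemma for \<open>f\<close> composed with the automorphisms that move \<open>a\<close> and \<open>f a\<close> to the
origin.\<close>

lemma Schwarz_Pick_open:
  assumes hol: "f holomorphic_on ball 0 1" and lt: "\<And>z. cmod z < 1 \<Longrightarrow> cmod (f z) < 1"
    and a: "cmod a < 1" and b: "cmod b < 1"
  shows "cmod (f a - f b) * cmod (1 - cnj a * b) \<le> cmod (a - b) * cmod (1 - cnj (f a) * f b)"
proof -
  define g where "g = Moebius_function 0 (f a) \<circ> f \<circ> Moebius_function 0 (- a)"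
  \<comment> \<open>The composition \<open>g\<close> fixes \<open>0\<close> and takes \<open>\<xi>\<close>, the image of \<open>b\<close>, to that of \<open>f b\<close>.\<close>
  define \<xi> where "\<xi> = Moebius_function 0 a b"
  have M: "Moebius_function 0 (- a) ` ball 0 1 \<subseteq> ball 0 1"
    using Moebius_function_norm_lt_1[of "-a"] a by auto
  have "g holomorphic_on ball 0 1"
    unfolding g_def
    by (intro holomorphic_on_compose_gen[where t = "ball 0 1"] Moebius_function_holomorphic hol M)
       (use lt a in auto)
  moreover have "g 0 = 0"
    by (simp add: g_def Moebius_function_of_zero Moebius_function_eq_zero)
  moreover have "cmod (g z) < 1" if "cmod z < 1" for z
    using that lt a by (simp add: g_def Moebius_function_norm_lt_1)
  moreover have "cmod \<xi> < 1" using a b by (simp add: \<xi>_def Moebius_function_norm_lt_1)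
  ultimately have "cmod (g \<xi>) \<le> cmod \<xi>" by (rule Schwarz_Lemma(1))
  moreover have "g \<xi> = Moebius_function 0 (f a) (f b)"
    using a b by (simp add: g_def \<xi>_def Moebius_function_inverse)
  ultimately have "cmod ((f b - f a) / (1 - cnj (f a) * f b)) \<le> cmod ((b - a) / (1 - cnj a * b))"
    by (simp add: \<xi>_def Moebius_function_simple)
  moreover have "cmod (1 - cnj (f a) * f b) > 0" "cmod (1 - cnj a * b) > 0"
    using one_minus_cnj_nonzero[of a b] one_minus_cnj_nonzero[of "f a" "f b"] lt[OF a] lt[OF b] a b
    by auto
  ultimately show ?thesis by (simp add: norm_divide field_simps norm_minus_commute)
qed

text \<open>There are two boundary phenomena. If an argument lies on the circle, then
\<open>|a - b| = |1 - cnj a b|\<close> and only the elementary bound on the values remains. Otherwise \<open>f\<close> may attain modulus \<open>1\<close>, and the open version is applied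
to \<open>t f\<close>, with \<open>t\<close> tending to \<open>1\<close> from below.\<close>

theorem Schwarz_Pick:
  assumes f: "f \<in> disk_algebra" and le: "\<And>z. cmod z \<le> 1 \<Longrightarrow> cmod (f z) \<le> 1"
    and a: "cmod a \<le> 1" and b: "cmod b \<le> 1"
  shows "cmod (f a - f b) * cmod (1 - cnj a * b) \<le> cmod (a - b) * cmod (1 - cnj (f a) * f b)"
proof (cases "cmod a = 1 \<or> cmod b = 1")
  case True
  then show ?thesis
    using cmod_diff_le_disc[OF le[OF a] le[OF b]] cmod_diff_eq_circle[of a b]
    by (metis mult.commute mult_left_mono norm_ge_zero)
next
  case False
  then have ab: "cmod a < 1" "cmod b < 1" using a b by auto
  have "\<forall>\<^sub>F t in at_left (1::real). t * cmod (f a - f b) * cmod (1 - cnj a * b)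
     \<le> cmod (a - b) * cmod (1 - (of_real t)\<^sup>2 * (cnj (f a) * f b))"
  proof (rule eventually_mono)
    show "\<forall>\<^sub>F t in at_left (1::real). t \<in> {0<..<1}"
      by (rule eventually_at_left_real) simp
    fix t :: real assume t: "t \<in> {0<..<1}"
    have "cmod (of_real t * f a - of_real t * f b) * cmod (1 - cnj a * b)
       \<le> cmod (a - b) * cmod (1 - cnj (of_real t * f a) * (of_real t * f b))"
    proof (rule Schwarz_Pick_open[OF _ _ ab])
      show "(\<lambda>z. of_real t * f z) holomorphic_on ball 0 1"
        using f by (auto simp: disk_algebra_def intro!: holomorphic_intros)
      show "cmod (of_real t * f z) < 1" if "cmod z < 1" for z
      proof -
        have "cmod (of_real t * f z) = t * cmod (f z)" using t by (simp add: norm_mult)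
        also have "\<dots> \<le> t * 1" using le[of z] t that by (intro mult_left_mono) auto
        finally show ?thesis using t by auto
      qed
    qed
    moreover have "cmod (of_real t * f a - of_real t * f b) = t * cmod (f a - f b)"
      using t by (simp add: norm_mult flip: right_diff_distrib)
    ultimately show "t * cmod (f a - f b) * cmod (1 - cnj a * b)
       \<le> cmod (a - b) * cmod (1 - (of_real t)\<^sup>2 * (cnj (f a) * f b))"
      by (simp add: power2_eq_square mult_ac)
  qed
  then have "1 * cmod (f a - f b) * cmod (1 - cnj a * b)
     \<le> cmod (a - b) * cmod (1 - (of_real 1)\<^sup>2 * (cnj (f a) * f b))"
    by (rule tendsto_le[OF trivial_limit_at_left_real, rotated 2])
       (intro tendsto_intros)+
  then show ?thesis by simp
qed

text \<open>Converse of Schwarz--Pick: move \<open>a\<close> to \<open>0\<close>, multiply by a constant \<open>c\<close> with \<open>|c| \<le> 1\<close>,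
and move \<open>0\<close> to \<open>w\<close>. The distance condition is exactly \<open>|c| \<le> 1\<close> for the constant that
takes the second point to the right place.\<close>

lemma Schwarz_Pick_interpolation:
  assumes a: "cmod a < 1" "cmod b < 1" "a \<noteq> b" and w: "cmod w < 1" "cmod u < 1"
    and le: "cmod (w - u) * cmod (1 - cnj a * b) \<le> cmod (a - b) * cmod (1 - cnj w * u)"
  obtains f where "f \<in> disk_algebra" "\<And>z. cmod z \<le> 1 \<Longrightarrow> cmod (f z) \<le> 1" "f a = w" "f b = u"
proof
  \<comment> \<open>Once \<open>a\<close> and \<open>w\<close> are moved to the origin, the function sought is multiplication by \<open>c\<close>.\<close>
  define c where "c = Moebius_function 0 w u / Moebius_function 0 a b"
  define f where "f = Moebius_function 0 (- w) \<circ> (\<lambda>z. c * z) \<circ> Moebius_function 0 a"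
  have nz: "cmod (1 - cnj a * b) > 0" "cmod (1 - cnj w * u) > 0"
    using one_minus_cnj_nonzero[of a b] one_minus_cnj_nonzero[of w u] a w by auto
  have ab: "Moebius_function 0 a b \<noteq> 0"
    using nz a by (simp add: Moebius_function_simple)
  have "cmod (Moebius_function 0 w u) \<le> cmod (Moebius_function 0 a b)"
    using le nz by (simp add: Moebius_function_simple norm_divide field_simps norm_minus_commute)
  then have c: "cmod c \<le> 1" using ab by (simp add: c_def norm_divide)
  have cz: "cmod (c * z) \<le> 1" if "cmod z \<le> 1" for z
    using mult_mono[OF c that] by (simp add: norm_mult)
  have cz': "cmod (c * z) < 1" if "cmod z < 1" for z
    using mult_right_mono[OF c, of "cmod z"] that by (simp add: norm_mult)
  note [simp] = Moebius_function_disk_algebra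
  show le1: "cmod (f z) \<le> 1" if "cmod z \<le> 1" for z
    using that cz a w by (auto simp: f_def)
  have "(\<lambda>z. c * z) \<in> disk_algebra"
    by (auto simp: disk_algebra_def intro!: continuous_intros holomorphic_intros)
  then show "f \<in> disk_algebra"
    unfolding f_def using a w cz cz'
    by (intro disk_algebra_compose) (auto simp: Moebius_function_norm_lt_1)
  show "f a = w" by (simp add: f_def Moebius_function_of_zero Moebius_function_eq_zero)
  show "f b = u"
    using ab w Moebius_function_inverse[of w u] by (simp add: f_def c_def)
qed

section \<open>Pick bodies of two points\<close>

lemma closed_pseudohyperbolic_pairs: "closed (pseudohyperbolic_pairs r)"
  unfolding pseudohyperbolic_pairs_def
  by (intro closed_Collect_conj closed_Collect_le continuous_intros)

lemma disk_algebra_scale: "f \<in> disk_algebra \<Longrightarrow> (\<lambda>z. c * f z) \<in> disk_algebra"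
  by (auto simp: disk_algebra_def intro!: continuous_intros holomorphic_intros)

lemma disk_algebra_const: "(\<lambda>z. c) \<in> disk_algebra"
  by (simp add: disk_algebra_def)

text \<open>Schwarz--Pick applies to an interpolating function divided by its bound \<open>1 + \<epsilon>\<close>, so it gives
the condition for \<open>w / (1 + \<epsilon>)\<close>; closedness of the target removes the \<open>\<epsilon>\<close>.\<close>

lemma pick_body_subset_pseudohyperbolic_pairs:
  fixes \<alpha> :: "2 \<Rightarrow> complex"
  assumes ne: "\<alpha> 1 \<noteq> \<alpha> 2" and le: "cmod (\<alpha> 1) \<le> 1" "cmod (\<alpha> 2) \<le> 1"
  shows "pick_body \<alpha> \<subseteq> pseudohyperbolic_pairs (pseudohyperbolic (\<alpha> 1) (\<alpha> 2))"
proof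
  fix w assume w: "w \<in> pick_body \<alpha>"
  have nz: "cmod (1 - cnj (\<alpha> 1) * \<alpha> 2) > 0"
    using one_minus_cnj_nonzero[of "\<alpha> 1" "\<alpha> 2"] ne le by auto
  have "\<forall>\<^sub>F \<epsilon> in at_right (0::real). of_real (1 / (1 + \<epsilon>)) *s w \<in> pseudohyperbolic_pairs (pseudohyperbolic (\<alpha> 1) (\<alpha> 2))"
  proof (rule eventually_mono)
    show "\<forall>\<^sub>F \<epsilon> in at_right (0::real). \<epsilon> > 0" by (rule eventually_at_right_less)
    fix \<epsilon> :: real assume \<epsilon>: "\<epsilon> > 0"
    then obtain f where f: "f \<in> disk_algebra" "disk_norm f \<le> 1 + \<epsilon>" "\<And>i. f (\<alpha> i) = w $ i"
      using w by (auto simp: pick_body_def)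
    define g where "g = (\<lambda>z. of_real (1 / (1 + \<epsilon>)) * f z)"
    have g: "g \<in> disk_algebra" unfolding g_def by (rule disk_algebra_scale[OF f(1)])
    have g1: "cmod (g z) \<le> 1" if "cmod z \<le> 1" for z
    proof -
      have "cmod (f z) \<le> 1 + \<epsilon>" using f(2) that by (simp add: disk_norm_le_iff[OF f(1)])
      then show ?thesis using \<epsilon> by (simp add: g_def norm_mult field_simps del: of_real_divide of_real_add)
    qed
    have "g (\<alpha> i) = (of_real (1 / (1 + \<epsilon>)) *s w) $ i" for i by (simp add: g_def f)
    then show "of_real (1 / (1 + \<epsilon>)) *s w \<in> pseudohyperbolic_pairs (pseudohyperbolic (\<alpha> 1) (\<alpha> 2))"
      using Schwarz_Pick[OF g g1 le] g1[OF le(1)] g1[OF le(2)] nz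
      by (simp add: pseudohyperbolic_pairs_def pseudohyperbolic_def field_simps del: vector_smult_component)
  qed
  moreover have "((\<lambda>\<epsilon>::real. of_real (1 / (1 + \<epsilon>)) *s w) \<longlongrightarrow> of_real (1 / (1 + 0)) *s w) (at_right 0)"
    unfolding vector_scalar_mult_def by (intro tendsto_intros) auto
  ultimately show "w \<in> pseudohyperbolic_pairs (pseudohyperbolic (\<alpha> 1) (\<alpha> 2))"
    using Lim_in_closed_set[OF closed_pseudohyperbolic_pairs] by (fastforce simp: trivial_limit_at_right_real)
qed

text \<open>For nodes in the open disc the infimum of the norms of interpolating functions is attained, which
makes the values available exactly and not only up to \<open>\<epsilon>\<close>. Since the distance of the nodes is less than \<open>1\<close>, target
values with an entry on the circle coincide and are met by a constant.\<close>

lemma pseudohyperbolic_pairs_interpolation: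
  fixes \<alpha> :: "2 \<Rightarrow> complex"
  assumes ne: "\<alpha> 1 \<noteq> \<alpha> 2" and lt: "cmod (\<alpha> 1) < 1" "cmod (\<alpha> 2) < 1"
    and w: "w \<in> pseudohyperbolic_pairs (pseudohyperbolic (\<alpha> 1) (\<alpha> 2))"
  obtains f where "f \<in> disk_algebra" "\<And>z. cmod z \<le> 1 \<Longrightarrow> cmod (f z) \<le> 1" "\<And>i. f (\<alpha> i) = w $ i"
proof (cases "w$1 = w$2")
  case True
  then have "\<forall>i. w $ 1 = w $ i" by (simp add: forall_2)
  then show ?thesis
    using w by (intro that[of "\<lambda>z. w$1"]) (auto simp: pseudohyperbolic_pairs_def disk_algebra_const)
next
  case False
  have nz: "cmod (1 - cnj (\<alpha> 1) * \<alpha> 2) > 0" "cmod (1 - cnj (w$1) * w$2) > 0"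
    using one_minus_cnj_nonzero[of "\<alpha> 1" "\<alpha> 2"] one_minus_cnj_nonzero[of "w$1" "w$2"] ne lt w False
    by (auto simp: pseudohyperbolic_pairs_def)
  have le: "cmod (w$1 - w$2) * cmod (1 - cnj (\<alpha> 1) * \<alpha> 2) \<le> cmod (\<alpha> 1 - \<alpha> 2) * cmod (1 - cnj (w$1) * w$2)"
    using w nz by (simp add: pseudohyperbolic_pairs_def pseudohyperbolic_def field_simps)
  have "(cmod (1 - cnj (\<alpha> 1) * \<alpha> 2))\<^sup>2 - (cmod (\<alpha> 1 - \<alpha> 2))\<^sup>2 > 0"
    unfolding pseudohyperbolic_identity using lt by (simp add: abs_square_less_1)
  then have "cmod (\<alpha> 1 - \<alpha> 2) < cmod (1 - cnj (\<alpha> 1) * \<alpha> 2)"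
    using power2_less_imp_less[of "cmod (\<alpha> 1 - \<alpha> 2)" "cmod (1 - cnj (\<alpha> 1) * \<alpha> 2)"] by simp
  then have "cmod (w$1 - w$2) \<noteq> cmod (1 - cnj (w$1) * w$2)"
    using le nz by (metis linorder_not_less mult.commute mult_less_cancel_left_pos)
  then have "cmod (w$1) < 1" "cmod (w$2) < 1"
    using cmod_diff_eq_circle[of "w$1" "w$2"] w by (auto simp: pseudohyperbolic_pairs_def less_le)
  from Schwarz_Pick_interpolation[OF lt ne this le] obtain f where
    f: "f \<in> disk_algebra" "\<And>z. cmod z \<le> 1 \<Longrightarrow> cmod (f z) \<le> 1" "f (\<alpha> 1) = w$1" "f (\<alpha> 2) = w$2"
    by blast
  have "\<forall>i. f (\<alpha> i) = w $ i" using f(3,4) by (simp add: forall_2)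
  then show ?thesis using that f(1,2) by blast
qed

text \<open>With a node on the circle every pair \<open>w\<close> in the closed bidisc is reached. Shrinking \<open>w\<close> by
\<open>1 + \<epsilon>\<close> makes its pseudohyperbolic distance less than \<open>1\<close>. The distance of the nodes
\<open>t \<alpha>\<^sub>1\<close> and \<open>t \<alpha>\<^sub>2\<close> tends to \<open>1\<close> as \<open>t\<close> does, so some \<open>t < 1\<close> admits a
contractive function interpolating at these interior nodes; its dilation solves the problem.\<close>

lemma bidisc_subset_pick_body_circle:
  fixes \<alpha> :: "2 \<Rightarrow> complex"
  assumes ne: "\<alpha> 1 \<noteq> \<alpha> 2" and le: "cmod (\<alpha> 1) \<le> 1" "cmod (\<alpha> 2) \<le> 1"
    and one: "cmod (\<alpha> 1) = 1 \<or> cmod (\<alpha> 2) = 1"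
    and w: "cmod (w$1) \<le> 1" "cmod (w$2) \<le> 1"
  shows "w \<in> pick_body \<alpha>"
  unfolding pick_body_def
proof (intro CollectI allI impI)
  fix \<epsilon> :: real assume \<epsilon>: "\<epsilon> > 0"
  define a b where "a = w$1 / of_real (1 + \<epsilon>)" and "b = w$2 / of_real (1 + \<epsilon>)"
  have ab: "cmod a < 1" "cmod b < 1"
    using w \<epsilon> by (simp_all add: a_def b_def norm_divide del: of_real_add)
  have "(cmod (1 - cnj a * b))\<^sup>2 - (cmod (a - b))\<^sup>2 > 0"
    unfolding pseudohyperbolic_identity using ab by (simp add: abs_square_less_1)
  then have lt: "cmod (a - b) < cmod (1 - cnj a * b)"
    using power2_less_imp_less[of "cmod (a - b)" "cmod (1 - cnj a * b)"] by simp
  have "((\<lambda>t::real. t * cmod (\<alpha> 1 - \<alpha> 2) * cmod (1 - cnj a * b)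
      - cmod (a - b) * cmod (1 - (of_real t)\<^sup>2 * (cnj (\<alpha> 1) * \<alpha> 2)))
    \<longlongrightarrow> 1 * cmod (\<alpha> 1 - \<alpha> 2) * cmod (1 - cnj a * b)
      - cmod (a - b) * cmod (1 - (of_real 1)\<^sup>2 * (cnj (\<alpha> 1) * \<alpha> 2))) (at_left 1)"
    by (intro tendsto_intros)
  moreover have "1 * cmod (\<alpha> 1 - \<alpha> 2) * cmod (1 - cnj a * b)
      - cmod (a - b) * cmod (1 - (of_real 1)\<^sup>2 * (cnj (\<alpha> 1) * \<alpha> 2)) > 0"
  proof -
    have "0 < cmod (1 - cnj (\<alpha> 1) * \<alpha> 2)" using ne by (simp flip: cmod_diff_eq_circle[OF one])
    from mult_strict_right_mono[OF lt this] show ?thesis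
      by (simp add: cmod_diff_eq_circle[OF one] mult.commute)
  qed
  ultimately have "\<forall>\<^sub>F t in at_left (1::real). t * cmod (\<alpha> 1 - \<alpha> 2) * cmod (1 - cnj a * b)
      - cmod (a - b) * cmod (1 - (of_real t)\<^sup>2 * (cnj (\<alpha> 1) * \<alpha> 2)) > 0"
    by (rule order_tendstoD)
  moreover have "\<forall>\<^sub>F t in at_left (1::real). t \<in> {0<..<1}"
    by (rule eventually_at_left_real) simp
  ultimately have "\<forall>\<^sub>F t in at_left (1::real). t \<in> {0<..<1} \<and> t * cmod (\<alpha> 1 - \<alpha> 2) * cmod (1 - cnj a * b)
      - cmod (a - b) * cmod (1 - (of_real t)\<^sup>2 * (cnj (\<alpha> 1) * \<alpha> 2)) > 0"
    by eventually_elim simp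
  from eventually_happens'[OF trivial_limit_at_left_real this]
  obtain t :: real where t: "0 < t" "t < 1" and tle: "t * cmod (\<alpha> 1 - \<alpha> 2) * cmod (1 - cnj a * b)
      - cmod (a - b) * cmod (1 - (of_real t)\<^sup>2 * (cnj (\<alpha> 1) * \<alpha> 2)) > 0"
    by auto
  \<comment> \<open>The dilation moves both nodes into the open disc.\<close>
  define T where "T = (\<lambda>z::complex. of_real t * z)"
  have T: "cmod (T z) < 1" if "cmod z \<le> 1" for z
  proof -
    have "t * cmod z \<le> t * 1" using that t by (intro mult_left_mono) auto
    then have "t * cmod z < 1" using t by linarith
    then show ?thesis using t by (simp add: T_def norm_mult)
  qed
  have "cmod (a - b) * cmod (1 - cnj (T (\<alpha> 1)) * T (\<alpha> 2)) \<le> cmod (T (\<alpha> 1) - T (\<alpha> 2)) * cmod (1 - cnj a * b)"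
    using tle t by (simp add: T_def norm_mult power2_eq_square mult_ac flip: right_diff_distrib)
  moreover have "T (\<alpha> 1) \<noteq> T (\<alpha> 2)" using ne t by (simp add: T_def)
  ultimately obtain f where f: "f \<in> disk_algebra" "\<And>z. cmod z \<le> 1 \<Longrightarrow> cmod (f z) \<le> 1"
      "f (T (\<alpha> 1)) = a" "f (T (\<alpha> 2)) = b"
    using Schwarz_Pick_interpolation[OF T[OF le(1)] T[OF le(2)] _ ab] by metis
  define F where "F = (\<lambda>z. of_real (1 + \<epsilon>) * (f \<circ> T) z)"
  have "T \<in> disk_algebra"
    unfolding T_def disk_algebra_def by (auto intro!: continuous_intros holomorphic_intros)
  then have F: "F \<in> disk_algebra"
    unfolding F_def using T f(1)
    by (intro disk_algebra_scale disk_algebra_compose) (auto simp: less_imp_le)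
  have "disk_norm F \<le> 1 + \<epsilon>"
    unfolding disk_norm_le_iff[OF F]
  proof
    fix z :: complex assume "z \<in> cball 0 1"
    then have "cmod (f (T z)) \<le> 1" using T[of z] f(2)[of "T z"] by simp
    then have "(1 + \<epsilon>) * cmod (f (T z)) \<le> (1 + \<epsilon>) * 1" using \<epsilon> by (intro mult_left_mono) auto
    then show "cmod (F z) \<le> 1 + \<epsilon>" using \<epsilon> by (simp add: F_def norm_mult del: of_real_add)
  qed
  moreover have "F (\<alpha> 1) = w$1" "F (\<alpha> 2) = w$2"
    using f(3,4) \<epsilon> by (auto simp: F_def a_def b_def simp del: of_real_add)
  then have "\<forall>i. F (\<alpha> i) = w $ i" by (simp add: forall_2)
  ultimately show "\<exists>f\<in>disk_algebra. disk_norm f \<le> 1 + \<epsilon> \<and> (\<forall>i. f (\<alpha> i) = w $ i)"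
    using F by blast
qed

lemma pick_body_eq_pseudohyperbolic_pairs:
  fixes \<alpha> :: "2 \<Rightarrow> complex"
  assumes ne: "\<alpha> 1 \<noteq> \<alpha> 2" and le: "cmod (\<alpha> 1) \<le> 1" "cmod (\<alpha> 2) \<le> 1"
  shows "pick_body \<alpha> = pseudohyperbolic_pairs (pseudohyperbolic (\<alpha> 1) (\<alpha> 2))"
proof
  show "pseudohyperbolic_pairs (pseudohyperbolic (\<alpha> 1) (\<alpha> 2)) \<subseteq> pick_body \<alpha>"
  proof
    fix w assume w: "w \<in> pseudohyperbolic_pairs (pseudohyperbolic (\<alpha> 1) (\<alpha> 2))"
    show "w \<in> pick_body \<alpha>"
    proof (cases "cmod (\<alpha> 1) = 1 \<or> cmod (\<alpha> 2) = 1")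
      case True
      then show ?thesis using w bidisc_subset_pick_body_circle[OF ne le] by (auto simp: pseudohyperbolic_pairs_def)
    next
      case False
      then obtain f where f: "f \<in> disk_algebra" "\<And>z. cmod z \<le> 1 \<Longrightarrow> cmod (f z) \<le> 1" "\<And>i. f (\<alpha> i) = w $ i"
        using pseudohyperbolic_pairs_interpolation[OF ne _ _ w] le by auto
      show ?thesis
        unfolding pick_body_def
      proof (intro CollectI allI impI bexI conjI)
        show "disk_norm f \<le> 1 + \<epsilon>" if "\<epsilon> > 0" for \<epsilon>
          unfolding disk_norm_le_iff[OF f(1)] using f(2) that by fastforce
      qed (use f in auto)
    qed
  qed
qed (rule pick_body_subset_pseudohyperbolic_pairs[OF assms])

theorem P_balls_eq: "P_balls = pseudohyperbolic_pairs ` {0<..1}"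
proof (intro equalityI subsetI)
  fix S :: "(complex^2) set" assume "S \<in> P_balls"
  then obtain \<alpha> :: "2 \<Rightarrow> complex" where \<alpha>: "S = pick_body \<alpha>" "inj \<alpha>" "\<And>i. cmod (\<alpha> i) \<le> 1"
    by (auto simp: P_balls_def)
  have ne: "\<alpha> 1 \<noteq> \<alpha> 2" using injD[OF \<alpha>(2), of 1 2] by auto
  have nz: "cmod (1 - cnj (\<alpha> 1) * \<alpha> 2) > 0"
    using one_minus_cnj_nonzero[of "\<alpha> 1" "\<alpha> 2"] ne \<alpha>(3) by auto
  have "pseudohyperbolic (\<alpha> 1) (\<alpha> 2) \<in> {0<..1}"
    using nz ne cmod_diff_le_disc[OF \<alpha>(3) \<alpha>(3), of 1 2] by (simp add: pseudohyperbolic_def)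
  then show "S \<in> pseudohyperbolic_pairs ` {0<..1}"
    using \<alpha>(1) pick_body_eq_pseudohyperbolic_pairs[OF ne \<alpha>(3) \<alpha>(3)] by blast
next
  fix S assume "S \<in> pseudohyperbolic_pairs ` {0<..1}"
  then obtain r where r: "0 < r" "r \<le> 1" "S = pseudohyperbolic_pairs r" by auto
  define \<alpha> :: "2 \<Rightarrow> complex" where "\<alpha> = (\<lambda>i. if i = 1 then 0 else of_real r)"
  have \<alpha>: "\<alpha> 1 = 0" "\<alpha> 2 = of_real r" by (auto simp: \<alpha>_def)
  have "inj \<alpha>" unfolding inj_def forall_2 using \<alpha> r by simp
  moreover have "\<forall>i. \<alpha> i \<in> cball 0 1" unfolding forall_2 using \<alpha> r by simp
  moreover have "S = pick_body \<alpha>"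
    using pick_body_eq_pseudohyperbolic_pairs[of \<alpha>] \<alpha> r by (simp add: pseudohyperbolic_def norm_of_real)
  ultimately show "S \<in> P_balls" unfolding P_balls_def by blast
qed

section \<open>Norms satisfying von Neumann's inequality\<close>

lemma axis_scale: "axis i c = c *s (axis i 1 :: complex^'k)"
  by (simp add: vec_eq_iff axis_def)

text \<open>Multiplying by the idempotent of the \<open>i\<close>-th coordinate turns \<open>v\<close> into a multiple of that
idempotent, which is an eigenvector with eigenvalue \<open>v $ i\<close>.\<close>

lemma coordinate_le_banach_algebra_norm:
  assumes "banach_algebra_norm N"
  shows "cmod (v $ i) \<le> N v"
proof -
  let ?e = "axis i 1"
  have pos: "N ?e > 0"
    using assms by (auto simp: banach_algebra_norm_def complex_norm_def less_le)
  have "v * ?e = (v $ i) *s ?e" by (simp add: vec_eq_iff axis_def)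
  then have "cmod (v $ i) * N ?e = N (v * ?e)"
    using assms by (simp add: banach_algebra_norm_def complex_norm_def)
  also have "\<dots> \<le> N v * N ?e" using assms by (simp add: banach_algebra_norm_def)
  finally show ?thesis using pos by simp
qed

text \<open>The common mechanism of the classification. The hypothesis says that, on the open bidisc, \<open>v\<close> is
in the ball iff \<open>(0, \<rho>)\<close> is, where \<open>\<rho>\<close> is the distance of its entries. This is the form
that invariance under disc automorphisms takes. A pair with an entry on the circle is either
constant or a limit of the pairs \<open>t v\<close>, to which the hypothesis applies.\<close>

lemma unit_ball_eq_pseudohyperbolic_pairs:
  fixes N :: "complex^2 \<Rightarrow> real"
  assumes N: "banach_algebra_norm N"
    and inv: "\<And>v. \<lbrakk>cmod (v$1) < 1; cmod (v$2) < 1\<rbrakk> \<Longrightarrow>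
      N v \<le> 1 \<longleftrightarrow> pseudohyperbolic (v$1) (v$2) * N (axis 2 1) \<le> 1"
  shows "unit_ball N = pseudohyperbolic_pairs (1 / N (axis 2 1))" and "1 / N (axis 2 1) \<in> {0<..1}"
proof -
  define r where "r = 1 / N (axis 2 1)"
  have ge1: "1 \<le> N (axis 2 1)"
    using coordinate_le_banach_algebra_norm[OF N, of "axis 2 1" 2] by simp
  then show "1 / N (axis 2 1) \<in> {0<..1}" by simp
  from ge1 have r: "0 < r" "r \<le> 1" "N (axis 2 1) = 1 / r" by (auto simp: r_def)
  have scale: "N (c *s v) = cmod c * N v" for c v
    using N by (simp add: banach_algebra_norm_def complex_norm_def)
  have "N 1 = 1" using N by (simp add: banach_algebra_norm_def)
  have interior: "N v \<le> 1 \<longleftrightarrow> v \<in> pseudohyperbolic_pairs r" if "cmod (v$1) < 1" "cmod (v$2) < 1" for v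
  proof -
    have "cmod (1 - cnj (v$1) * v$2) > 0"
      using one_minus_cnj_nonzero[of "v$1" "v$2"] that by auto
    then show ?thesis
      using inv[OF that] r that by (simp add: pseudohyperbolic_pairs_def pseudohyperbolic_def field_simps)
  qed
  have shrink: "cmod ((of_real t *s v) $ i) < 1" if "cmod (v$i) \<le> 1" "0 < t" "t < 1" for v :: "complex^2" and i t
  proof -
    have "t * cmod (v$i) \<le> t * 1" using that by (intro mult_left_mono) auto
    then have "t * cmod (v$i) < 1" using that by linarith
    then show ?thesis using that by (simp add: norm_mult)
  qed
  have "v \<in> pseudohyperbolic_pairs r" if "N v \<le> 1" for v
  proof -
    have le: "cmod (v$i) \<le> 1" for i
      using coordinate_le_banach_algebra_norm[OF N, of v i] that by simp
    have "of_real t *s v \<in> pseudohyperbolic_pairs r" if t: "t \<in> {0<..<1}" for t :: real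
    proof -
      have "N (of_real t *s v) \<le> 1"
        using t \<open>N v \<le> 1\<close> mult_mono[of t 1 "N v" 1] r N
        by (auto simp: scale banach_algebra_norm_def complex_norm_def)
      then show ?thesis using interior shrink[OF le, of t] t by simp
    qed
    moreover have "\<forall>\<^sub>F t in at_left (1::real). t \<in> {0<..<1}"
      by (rule eventually_at_left_real) simp
    ultimately have "\<forall>\<^sub>F t in at_left (1::real). of_real t *s v \<in> pseudohyperbolic_pairs r"
      by (auto elim: eventually_mono)
    moreover have "((\<lambda>t::real. of_real t *s v) \<longlongrightarrow> of_real 1 *s v) (at_left 1)"
      unfolding vector_scalar_mult_def by (intro tendsto_intros)
    ultimately show "v \<in> pseudohyperbolic_pairs r"
      using Lim_in_closed_set[OF closed_pseudohyperbolic_pairs] by fastforce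
  qed
  moreover have "N v \<le> 1" if v: "v \<in> pseudohyperbolic_pairs r" for v
  proof -
    have le: "cmod (v$1) \<le> 1" "cmod (v$2) \<le> 1" using v by (auto simp: pseudohyperbolic_pairs_def)
    consider "cmod (v$1) < 1" "cmod (v$2) < 1" | "v$1 = v$2"
      | "v$1 \<noteq> v$2" "cmod (v$1) = 1 \<or> cmod (v$2) = 1" using le by fastforce
    then show ?thesis
    proof cases
      case 1
      then show ?thesis using interior v by simp
    next
      case 2
      then have "v = (v$1) *s 1" by (simp add: vec_eq_iff forall_2)
      then have "N v = cmod (v$1)" using scale[of "v$1" 1] \<open>N 1 = 1\<close> by simp
      then show ?thesis using le by simp
    next
      case 3
      have "cmod (v$1 - v$2) > 0" using 3(1) by simp
      moreover have "cmod (v$1 - v$2) \<le> r * cmod (v$1 - v$2)"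
        using v by (simp add: pseudohyperbolic_pairs_def cmod_diff_eq_circle[OF 3(2)])
      ultimately have "r = 1" using r(2) by simp
      have "t * N v \<le> 1" if t: "0 < t" "t < 1" for t
      proof -
        have small: "cmod ((of_real t *s v) $ 1) < 1" "cmod ((of_real t *s v) $ 2) < 1"
          using shrink le t by blast+
        have "of_real t *s v \<in> pseudohyperbolic_pairs r"
          using small cmod_diff_le_disc[of "(of_real t *s v) $ 1" "(of_real t *s v) $ 2"] \<open>r = 1\<close>
          unfolding pseudohyperbolic_pairs_def by simp
        then show ?thesis using interior[OF small] scale t by simp
      qed
      then show ?thesis by (rule field_le_mult_one_interval)
    qed
  qed
  ultimately show "unit_ball N = pseudohyperbolic_pairs (1 / N (axis 2 1))"
    by (auto simp: unit_ball_def r_def)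
qed

lemma poly_map_poly_vec: "poly (map_poly vec p) v $ i = poly p (v $ i)"
  by (induction p) (simp_all add: map_poly_pCons)

lemma von_neumannD:
  assumes "von_neumann N" "N v \<le> 1" "\<And>z. cmod z \<le> 1 \<Longrightarrow> cmod (poly p z) \<le> M"
  shows "N (poly (map_poly vec p) v) \<le> M"
proof -
  have "(SUP z\<in>{z. cmod z \<le> 1}. cmod (poly p z)) \<le> M"
    by (rule cSUP_least) (auto intro: assms(3) exI[of _ 0])
  then show ?thesis using assms(1,2) unfolding von_neumann_def by (meson order_trans)
qed

text \<open>The numerator \<open>z - a\<close> times a partial sum of the geometric series for
\<open>1 / (1 - cnj a z)\<close>. The relative error in approximating the automorphism is exactly
\<open>(cnj a z)^n\<close>, also when \<open>z\<close> is an element of the algebra.\<close>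

definition Moebius_partial_poly :: "complex \<Rightarrow> nat \<Rightarrow> complex poly" where
  "Moebius_partial_poly a n = [:-a, 1:] * (\<Sum>j<n. monom (cnj a ^ j) j)"

lemma poly_Moebius_partial_poly:
  assumes "cmod a < 1" "cmod z \<le> 1"
  shows "poly (Moebius_partial_poly a n) z = Moebius_function 0 a z * (1 - (cnj a * z) ^ n)"
proof -
  have "1 - cnj a * z \<noteq> 0" using one_minus_cnj_nonzero[of a z] assms by auto
  moreover have "poly (Moebius_partial_poly a n) z = (z - a) * (\<Sum>j<n. (cnj a * z) ^ j)"
    by (simp add: Moebius_partial_poly_def poly_sum poly_monom power_mult_distrib left_diff_distrib)
  ultimately show ?thesis
    by (simp add: Moebius_function_simple one_diff_power_eq)
qed

lemma power_banach_algebra_norm: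
  assumes "banach_algebra_norm N"
  shows "N (v ^ n) \<le> N v ^ n"
proof (induction n)
  case (Suc n)
  have "N (v ^ Suc n) \<le> N v * N (v ^ n)" using assms by (simp add: banach_algebra_norm_def)
  also have "\<dots> \<le> N v * N v ^ n"
    using Suc assms by (intro mult_left_mono) (auto simp: banach_algebra_norm_def complex_norm_def)
  finally show ?case by simp
qed (use assms in \<open>simp add: banach_algebra_norm_def\<close>)

text \<open>Let \<open>u\<close> be the image of \<open>v\<close>. Von Neumann's inequality bounds the polynomial approximation by
\<open>1 + |a|^n\<close>, and the remainder is \<open>u x^n\<close> with \<open>\<parallel>x\<parallel> \<le> |a|\<close>. So
\<open>\<parallel>u\<parallel> \<le> 1 + |a|^n + \<parallel>u\<parallel> |a|^n\<close>, and \<open>n\<close> tends to infinity.\<close>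

lemma von_neumann_Moebius:
  assumes N: "banach_algebra_norm N" and vN: "von_neumann N"
    and v: "N v \<le> 1" and a: "cmod a < 1" and u: "\<And>i. u $ i = Moebius_function 0 a (v $ i)"
  shows "N u \<le> 1"
proof -
  define x where "x = cnj a *s v"
  have Nx: "N x \<le> cmod a" "0 \<le> N x" "0 \<le> N u"
    using N v mult_left_mono[OF v, of "cmod a"]
    by (auto simp: x_def banach_algebra_norm_def complex_norm_def)
  have v1: "cmod (v $ i) \<le> 1" for i
    using coordinate_le_banach_algebra_norm[OF N, of v i] v by simp
  have bound: "N u \<le> 1 + cmod a ^ n + N u * cmod a ^ n" for n
  proof -
    let ?p = "poly (map_poly vec (Moebius_partial_poly a n)) v"
    have pow: "(x ^ n) $ i = (x $ i) ^ n" for i by (induction n) auto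
    have "u = ?p + u * x ^ n"
      unfolding vec_eq_iff
      by (simp add: poly_map_poly_vec poly_Moebius_partial_poly[OF a v1] u pow)
         (simp add: x_def algebra_simps)
    then have "N u \<le> N ?p + N (u * x ^ n)"
      using N by (metis banach_algebra_norm_def complex_norm_def)
    also have "N ?p \<le> 1 + cmod a ^ n"
    proof (rule von_neumannD[OF vN v])
      fix z :: complex assume z: "cmod z \<le> 1"
      have "cmod (1 - (cnj a * z) ^ n) \<le> cmod 1 + cmod ((cnj a * z) ^ n)"
        by (rule norm_triangle_ineq4)
      also have "cmod ((cnj a * z) ^ n) = (cmod a * cmod z) ^ n"
        by (simp add: norm_power norm_mult)
      also have "\<dots> \<le> cmod a ^ n"
        using z by (intro power_mono) (auto simp: mult_left_le)
      finally have "cmod (1 - (cnj a * z) ^ n) \<le> 1 + cmod a ^ n" by simp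
      from mult_mono[OF Moebius_function_disk_algebra(2)[OF a z] this]
      show "cmod (poly (Moebius_partial_poly a n) z) \<le> 1 + cmod a ^ n"
        by (simp add: poly_Moebius_partial_poly[OF a z] norm_mult)
    qed
    also have "N (u * x ^ n) \<le> N u * N (x ^ n)" using N by (simp add: banach_algebra_norm_def)
    also have "N (x ^ n) \<le> N x ^ n" by (rule power_banach_algebra_norm[OF N])
    also have "N x ^ n \<le> cmod a ^ n" using Nx by (intro power_mono) auto
    finally show ?thesis using Nx by (simp add: mult_left_mono)
  qed
  have "(\<lambda>n. 1 + cmod a ^ n + N u * cmod a ^ n) \<longlonglongrightarrow> 1 + 0 + N u * 0"
    using a by (intro tendsto_intros LIMSEQ_power_zero) auto
  then have "N u \<le> 1 + 0 + N u * 0" by (rule LIMSEQ_le_const) (use bound in blast)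
  then show ?thesis by simp
qed

text \<open>The automorphism taking \<open>v\<^sub>1\<close> to \<open>0\<close> maps \<open>v\<close> to \<open>(0, d)\<close> with \<open>|d|\<close> the
distance of the entries; together with its inverse it gives the equivalence needed for
\<open>unit_ball_eq_pseudohyperbolic_pairs\<close>.\<close>

lemma von_neumann_unit_ball:
  fixes N :: "complex^2 \<Rightarrow> real"
  assumes N: "banach_algebra_norm N" and vN: "von_neumann N"
  shows "unit_ball N \<in> pseudohyperbolic_pairs ` {0<..1}"
proof -
  have "N v \<le> 1 \<longleftrightarrow> pseudohyperbolic (v$1) (v$2) * N (axis 2 1) \<le> 1"
    if lt: "cmod (v$1) < 1" "cmod (v$2) < 1" for v
  proof -
    define d where "d = Moebius_function 0 (v$1) (v$2)"
    have "N (axis 2 d) = cmod d * N (axis 2 1)"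
      using N by (subst axis_scale) (simp add: banach_algebra_norm_def complex_norm_def)
    also have "cmod d = pseudohyperbolic (v$1) (v$2)"
      by (simp add: d_def Moebius_function_simple pseudohyperbolic_def norm_divide norm_minus_commute)
    finally have Nd: "N (axis 2 d) = pseudohyperbolic (v$1) (v$2) * N (axis 2 1)" .
    have "\<forall>i. axis 2 d $ i = Moebius_function 0 (v$1) (v$i)"
      by (simp add: forall_2 axis_def d_def Moebius_function_eq_zero)
    then have to: "axis 2 d $ i = Moebius_function 0 (v$1) (v$i)" for i by blast
    have "\<forall>i. v $ i = Moebius_function 0 (- (v$1)) (axis 2 d $ i)"
      using Moebius_function_inverse[OF lt(1), of "v$2"] lt
      by (simp add: forall_2 axis_def d_def Moebius_function_of_zero)
    then have from_axis: "v $ i = Moebius_function 0 (- (v$1)) (axis 2 d $ i)" for i by blast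
    have "N v \<le> 1" if "N (axis 2 d) \<le> 1"
      by (rule von_neumann_Moebius[OF N vN that _ from_axis]) (use lt in simp)
    moreover have "N (axis 2 d) \<le> 1" if "N v \<le> 1"
      by (rule von_neumann_Moebius[OF N vN that lt(1) to])
    ultimately show ?thesis using Nd by auto
  qed
  from unit_ball_eq_pseudohyperbolic_pairs[OF N this] show ?thesis by blast
qed

section \<open>Oblique idempotents on a Hilbert space\<close>

text \<open>Positivity of a Hermitian form in two variables with diagonal \<open>A\<close>, \<open>B\<close> and off-diagonal entry
\<open>k\<close>. For necessity the phase of \<open>s\<close> is chosen to make the mixed term as negative as possible.\<close>

lemma binary_hermitian_form_nonneg_iff:
  fixes k :: complex
  assumes "0 \<le> A" "0 \<le> B"
  shows "(\<forall>s t. 0 \<le> A * (cmod s)\<^sup>2 + B * (cmod t)\<^sup>2 + 2 * Re (k * s * cnj t)) \<longleftrightarrow> (cmod k)\<^sup>2 \<le> A * B"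
    (is "?pos \<longleftrightarrow> _")
proof
  assume pos: ?pos
  have *: "0 \<le> A * (cmod k)\<^sup>2 + B * \<tau>\<^sup>2 - 2 * (cmod k)\<^sup>2 * \<tau>" for \<tau> :: real
  proof -
    have eq: "Re (k * (- cnj k) * cnj (of_real \<tau>)) = - (cmod k)\<^sup>2 * \<tau>"
      unfolding cmod_power2 by (simp add: algebra_simps power2_eq_square)
    show ?thesis using pos[rule_format, of "- cnj k" "of_real \<tau>"] unfolding eq by simp
  qed
  show "(cmod k)\<^sup>2 \<le> A * B"
  proof (cases "A = 0")
    case True
    \<comment> \<open>Minimising in \<open>\<tau>\<close> would divide by \<open>B\<close>; dividing by \<open>B + 1\<close> covers \<open>B = 0\<close> as well.\<close>
    define q where "q = (cmod k)\<^sup>2 / (B + 1)"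
    have q: "(cmod k)\<^sup>2 = q * (B + 1)" using assms by (simp add: q_def)
    have "0 \<le> B * q\<^sup>2 - 2 * (cmod k)\<^sup>2 * q" using *[of q] True by simp
    also have "\<dots> = - ((B + 2) * q\<^sup>2)" unfolding q by (simp add: algebra_simps power2_eq_square)
    finally have "q = 0" using assms by (simp add: mult_le_0_iff)
    then show ?thesis using assms True q by simp
  next
    case False
    have "0 \<le> A * (A * B - (cmod k)\<^sup>2)" using *[of A] by (simp add: algebra_simps power2_eq_square)
    then show ?thesis using False assms by (simp add: zero_le_mult_iff)
  qed
next
  assume le: "(cmod k)\<^sup>2 \<le> A * B"
  show ?pos
  proof (intro allI)
    fix s t
    define a b where "a = sqrt A * cmod s" and "b = sqrt B * cmod t"
    have "cmod k \<le> sqrt A * sqrt B"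
      using le real_le_rsqrt by (simp add: real_sqrt_mult[symmetric])
    then have "cmod k * (cmod s * cmod t) \<le> (sqrt A * sqrt B) * (cmod s * cmod t)"
      by (intro mult_right_mono) auto
    then have "cmod (k * s * cnj t) \<le> a * b" by (simp add: norm_mult a_def b_def mult_ac)
    then have "- (a * b) \<le> Re (k * s * cnj t)"
      using abs_Re_le_cmod[of "k * s * cnj t"] by linarith
    moreover have "A * (cmod s)\<^sup>2 = a\<^sup>2" "B * (cmod t)\<^sup>2 = b\<^sup>2"
      using assms by (simp_all add: a_def b_def power_mult_distrib)
    moreover have "0 \<le> (a - b)\<^sup>2" by simp
    ultimately show "0 \<le> A * (cmod s)\<^sup>2 + B * (cmod t)\<^sup>2 + 2 * Re (k * s * cnj t)"
      by (simp add: power2_diff)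
  qed
qed

lemma complex_field_simps [simp]:
  "carrier complex_field = UNIV" "mult complex_field = (*)" "one complex_field = 1"
  "zero complex_field = 0" "add complex_field = (+)"
  by (simp_all add: complex_field_def)

context complex_hilbert_space
begin

lemma cinner_add_right:
  assumes "x \<in> carrier E" "y \<in> carrier E" "z \<in> carrier E"
  shows "cinner E z (x \<oplus>\<^bsub>E\<^esub> y) = cinner E z x + cinner E z y"
  using assms cinner_commute[of z "x \<oplus>\<^bsub>E\<^esub> y"] cinner_commute[of z x] cinner_commute[of z y]
  by (simp add: cinner_add_left)

lemma cinner_smult_right:
  assumes "x \<in> carrier E" "y \<in> carrier E"
  shows "cinner E x (c \<odot>\<^bsub>E\<^esub> y) = cnj c * cinner E x y"
  using assms cinner_commute[of x "c \<odot>\<^bsub>E\<^esub> y"] cinner_commute[of x y] smult_closed[of c y]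
  by (simp add: cinner_smult_left)

lemma cinner_zero: "cinner E \<zero>\<^bsub>E\<^esub> \<zero>\<^bsub>E\<^esub> = 0"
  using cinner_smult_left[of "\<zero>\<^bsub>E\<^esub>" "\<zero>\<^bsub>E\<^esub>" 0] smult_l_null[of "\<zero>\<^bsub>E\<^esub>"] by simp

lemma cinner_self: "x \<in> carrier E \<Longrightarrow> cinner E x x = of_real ((hnorm E x)\<^sup>2)"
proof -
  assume x: "x \<in> carrier E"
  have "Re (cinner E x x) \<ge> 0"
    using cinner_pos[OF x] cinner_zero by (cases "x = \<zero>\<^bsub>E\<^esub>") auto
  moreover have "Im (cinner E x x) = 0"
    using arg_cong[OF cinner_commute[OF x x], of Im] by simp
  ultimately show ?thesis by (simp add: hnorm_def complex_eq_iff)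
qed

lemma hnorm_nonneg: "x \<in> carrier E \<Longrightarrow> 0 \<le> hnorm E x"
  using cinner_pos[of x] cinner_zero by (cases "x = \<zero>\<^bsub>E\<^esub>") (auto simp: hnorm_def)

lemma hnorm_zero: "hnorm E \<zero>\<^bsub>E\<^esub> = 0"
  by (simp add: hnorm_def cinner_zero)

lemma hnorm_pos: "x \<in> carrier E \<Longrightarrow> x \<noteq> \<zero>\<^bsub>E\<^esub> \<Longrightarrow> 0 < hnorm E x"
  by (simp add: hnorm_def cinner_pos)

lemma hnorm_smult: "x \<in> carrier E \<Longrightarrow> hnorm E (c \<odot>\<^bsub>E\<^esub> x) = cmod c * hnorm E x"
proof -
  assume x: "x \<in> carrier E"
  then have cx: "c \<odot>\<^bsub>E\<^esub> x \<in> carrier E" by (simp add: smult_closed)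
  have "of_real ((hnorm E (c \<odot>\<^bsub>E\<^esub> x))\<^sup>2) = cinner E (c \<odot>\<^bsub>E\<^esub> x) (c \<odot>\<^bsub>E\<^esub> x)"
    by (rule cinner_self[OF cx, symmetric])
  also have "\<dots> = c * (cnj c * cinner E x x)"
    using x cx by (simp add: cinner_smult_left cinner_smult_right)
  also have "\<dots> = c * (cnj c * of_real ((hnorm E x)\<^sup>2))" by (simp only: cinner_self[OF x])
  also have "\<dots> = of_real ((cmod c * hnorm E x)\<^sup>2)"
    by (simp add: power_mult_distrib complex_norm_square del: of_real_power flip: mult.assoc)
  finally have "(hnorm E (c \<odot>\<^bsub>E\<^esub> x))\<^sup>2 = (cmod c * hnorm E x)\<^sup>2" by (simp only: of_real_eq_iff)
  then show ?thesis
    using x smult_closed[of c x] hnorm_nonneg by (simp add: power2_eq_iff_nonneg)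
qed

lemma hnorm_combination:
  assumes "y \<in> carrier E" "z \<in> carrier E"
  shows "(hnorm E (a \<odot>\<^bsub>E\<^esub> y \<oplus>\<^bsub>E\<^esub> b \<odot>\<^bsub>E\<^esub> z))\<^sup>2 =
    (cmod a)\<^sup>2 * (hnorm E y)\<^sup>2 + (cmod b)\<^sup>2 * (hnorm E z)\<^sup>2 + 2 * Re (a * cnj b * cinner E y z)"
proof -
  let ?u = "a \<odot>\<^bsub>E\<^esub> y" and ?w = "b \<odot>\<^bsub>E\<^esub> z"
  have c: "?u \<in> carrier E" "?w \<in> carrier E" using assms by (auto intro: smult_closed)
  have "cinner E (?u \<oplus>\<^bsub>E\<^esub> ?w) (?u \<oplus>\<^bsub>E\<^esub> ?w) =
      cinner E ?u ?u + cinner E ?w ?w + (cinner E ?u ?w + cnj (cinner E ?u ?w))"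
    using c cinner_commute[of ?w ?u] by (simp add: cinner_add_left cinner_add_right)
  also have "\<dots> = of_real ((hnorm E ?u)\<^sup>2 + (hnorm E ?w)\<^sup>2 + 2 * Re (cinner E ?u ?w))"
    unfolding complex_add_cnj using c by (simp add: cinner_self)
  finally have "(hnorm E (?u \<oplus>\<^bsub>E\<^esub> ?w))\<^sup>2 = (hnorm E ?u)\<^sup>2 + (hnorm E ?w)\<^sup>2 + 2 * Re (cinner E ?u ?w)"
    using c by (simp only: cinner_self a_closed of_real_eq_iff)
  also have "cinner E ?u ?w = a * cnj b * cinner E y z"
    using assms c by (simp add: cinner_smult_left cinner_smult_right)
  finally show ?thesis using assms by (simp only: hnorm_smult power_mult_distrib)
qed

lemma bdd_above_operator_norm:
  assumes T: "bounded_operator E T"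
  shows "bdd_above ((\<lambda>x. hnorm E (T x)) ` {x \<in> carrier E. hnorm E x \<le> 1})"
proof -
  from T obtain M where M: "\<And>x. x \<in> carrier E \<Longrightarrow> hnorm E (T x) \<le> M * hnorm E x"
    unfolding bounded_operator_def by blast
  show ?thesis
  proof (rule bdd_aboveI2)
    fix x assume x: "x \<in> {x \<in> carrier E. hnorm E x \<le> 1}"
    have "M * hnorm E x \<le> \<bar>M\<bar> * hnorm E x"
      using x by (intro mult_right_mono hnorm_nonneg) auto
    also have "\<dots> \<le> \<bar>M\<bar> * 1" using x by (intro mult_left_mono) auto
    finally show "hnorm E (T x) \<le> \<bar>M\<bar>" using M[of x] x by auto
  qed
qed

lemma operator_norm_nonneg:
  assumes "bounded_operator E T"
  shows "0 \<le> operator_norm E T"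
proof -
  have "0 \<le> hnorm E (T \<zero>\<^bsub>E\<^esub>)"
    using assms by (intro hnorm_nonneg) (simp add: bounded_operator_def)
  also have "\<dots> \<le> operator_norm E T"
    unfolding operator_norm_def using hnorm_zero
    by (intro cSUP_upper bdd_above_operator_norm[OF assms]) simp
  finally show ?thesis .
qed

lemma operator_norm_le_iff:
  assumes T: "bounded_operator E T" and K: "0 \<le> K"
  shows "operator_norm E T \<le> K \<longleftrightarrow> (\<forall>x\<in>carrier E. hnorm E (T x) \<le> K * hnorm E x)"
proof -
  from T obtain M where M: "\<And>x. x \<in> carrier E \<Longrightarrow> hnorm E (T x) \<le> M * hnorm E x"
    unfolding bounded_operator_def by blast
  have Tc: "T x \<in> carrier E" if "x \<in> carrier E" for x
    using T that by (auto simp: bounded_operator_def)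
  let ?B = "{x \<in> carrier E. hnorm E x \<le> 1}"
  have "bdd_above ((\<lambda>x. hnorm E (T x)) ` ?B)" by (rule bdd_above_operator_norm[OF T])
  moreover have "?B \<noteq> {}" using hnorm_zero by auto
  ultimately have "operator_norm E T \<le> K \<longleftrightarrow> (\<forall>x\<in>?B. hnorm E (T x) \<le> K)"
    unfolding operator_norm_def by (intro cSUP_le_iff)
  also have "\<dots> \<longleftrightarrow> (\<forall>x\<in>carrier E. hnorm E (T x) \<le> K * hnorm E x)"
  proof (intro iffI ballI)
    fix x assume le: "\<forall>x\<in>?B. hnorm E (T x) \<le> K" and x: "x \<in> carrier E"
    show "hnorm E (T x) \<le> K * hnorm E x"
    proof (cases "x = \<zero>\<^bsub>E\<^esub>")
      case True
      then show ?thesis using M[OF x] by (simp add: hnorm_zero)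
    next
      case False
      define c :: complex where "c = of_real (1 / hnorm E x)"
      have pos: "hnorm E x > 0" using hnorm_pos[OF x False] .
      have "hnorm E (T (c \<odot>\<^bsub>E\<^esub> x)) \<le> K"
        using le x pos by (simp add: hnorm_smult c_def norm_divide smult_closed)
      also have "T (c \<odot>\<^bsub>E\<^esub> x) = c \<odot>\<^bsub>E\<^esub> T x" using T x by (simp add: bounded_operator_def)
      finally show ?thesis
        using pos Tc[OF x] by (simp add: hnorm_smult c_def norm_divide field_simps)
    qed
  next
    fix x assume le: "\<forall>x\<in>carrier E. hnorm E (T x) \<le> K * hnorm E x" and x: "x \<in> ?B"
    then have "hnorm E (T x) \<le> K * hnorm E x" by blast
    also have "\<dots> \<le> K * 1" using x K by (intro mult_left_mono) auto
    finally show "hnorm E (T x) \<le> K" by simp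
  qed
  finally show ?thesis .
qed

text \<open>Write \<open>x = P x + Q x\<close> with the images \<open>P\<close>, \<open>Q\<close> of the two idempotents. Then
\<open>\<parallel>x\<parallel>\<^sup>2 - \<parallel>\<pi>(v) x\<parallel>\<^sup>2\<close> is a Hermitian form in these two components. Replacing \<open>x\<close> by
\<open>\<pi>(s, t) x\<close> scales the components independently, so the form is nonnegative for all
scalings, and the stated inequality is its discriminant condition.\<close>

lemma representation_contraction_iff:
  fixes \<pi> :: "complex^2 \<Rightarrow> 'a \<Rightarrow> 'a"
  assumes rep: "unital_isometric_representation N E \<pi>"
    and lt: "cmod (v$1) < 1" "cmod (v$2) < 1"
  shows "N v \<le> 1 \<longleftrightarrow>
    (\<forall>x\<in>carrier E. (cmod (1 - cnj (v$1) * v$2))\<^sup>2 * (cmod (cinner E (\<pi> (axis 1 1) x) (\<pi> (axis 2 1) x)))\<^sup>2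
      \<le> ((1 - (cmod (v$1))\<^sup>2) * (1 - (cmod (v$2))\<^sup>2)) *
        ((hnorm E (\<pi> (axis 1 1) x))\<^sup>2 * (hnorm E (\<pi> (axis 2 1) x))\<^sup>2))"
proof -
  define P Q where "P = \<pi> (axis 1 1)" and "Q = \<pi> (axis 2 1)"
  define A B where "A = (\<lambda>x. (1 - (cmod (v$1))\<^sup>2) * (hnorm E (P x))\<^sup>2)"
    and "B = (\<lambda>x. (1 - (cmod (v$2))\<^sup>2) * (hnorm E (Q x))\<^sup>2)"
  define k where "k = (\<lambda>x. (1 - v$1 * cnj (v$2)) * cinner E (P x) (Q x))"
  have bd: "bounded_operator E (\<pi> u)" for u using rep by (simp add: unital_isometric_representation_def)
  then have cl: "\<pi> u x \<in> carrier E" if "x \<in> carrier E" for u x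
    using that by (auto simp: bounded_operator_def)
  have mult: "\<pi> u (\<pi> w x) = \<pi> (u * w) x" and scale: "\<pi> (c *s u) x = c \<odot>\<^bsub>E\<^esub> \<pi> u x"
    if "x \<in> carrier E" for u w c x
    using rep that by (simp_all add: unital_isometric_representation_def)
  have split: "\<pi> u x = (u$1) \<odot>\<^bsub>E\<^esub> P x \<oplus>\<^bsub>E\<^esub> (u$2) \<odot>\<^bsub>E\<^esub> Q x" if "x \<in> carrier E" for u x
  proof -
    have "u = (u$1) *s axis 1 1 + (u$2) *s axis 2 1"
      by (simp add: vec_eq_iff forall_2 axis_def)
    then have "\<pi> u x = \<pi> ((u$1) *s axis 1 1 + (u$2) *s axis 2 1) x" by simp
    also have "\<dots> = (u$1) \<odot>\<^bsub>E\<^esub> P x \<oplus>\<^bsub>E\<^esub> (u$2) \<odot>\<^bsub>E\<^esub> Q x"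
      using rep that unfolding unital_isometric_representation_def P_def Q_def by simp
    finally show ?thesis .
  qed
  have square: "(hnorm E (\<pi> u x))\<^sup>2 = (cmod (u$1))\<^sup>2 * (hnorm E (P x))\<^sup>2 + (cmod (u$2))\<^sup>2 * (hnorm E (Q x))\<^sup>2
      + 2 * Re (u$1 * cnj (u$2) * cinner E (P x) (Q x))" if "x \<in> carrier E" for u x
    unfolding split[OF that] using cl[OF that] by (intro hnorm_combination) (auto simp: P_def Q_def)
  have defect: "(hnorm E x)\<^sup>2 - (hnorm E (\<pi> v x))\<^sup>2 = A x + B x + 2 * Re (k x)" if "x \<in> carrier E" for x
  proof -
    have "\<pi> 1 x = x" using rep that by (simp add: unital_isometric_representation_def)
    then show ?thesis
      using square[OF that, of 1] square[OF that, of v]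
      by (simp add: A_def B_def k_def algebra_simps)
  qed
  have scaled: "A (\<pi> u x) = A x * (cmod (u$1))\<^sup>2" "B (\<pi> u x) = B x * (cmod (u$2))\<^sup>2"
    "k (\<pi> u x) = k x * u$1 * cnj (u$2)" if "x \<in> carrier E" for u x
  proof -
    have "axis 1 1 * u = (u$1) *s axis 1 1" "axis 2 1 * u = (u$2) *s axis 2 1"
      by (simp_all add: vec_eq_iff forall_2 axis_def)
    then have "P (\<pi> u x) = (u$1) \<odot>\<^bsub>E\<^esub> P x" "Q (\<pi> u x) = (u$2) \<odot>\<^bsub>E\<^esub> Q x"
      using mult[OF that] scale[OF that] by (simp_all only: P_def Q_def)
    then show "A (\<pi> u x) = A x * (cmod (u$1))\<^sup>2" "B (\<pi> u x) = B x * (cmod (u$2))\<^sup>2"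
      "k (\<pi> u x) = k x * u$1 * cnj (u$2)"
      using cl[OF that, of "axis 1 1"] cl[OF that, of "axis 2 1"]
      by (simp_all add: A_def B_def k_def hnorm_smult cinner_smult_left cinner_smult_right smult_closed
          power_mult_distrib P_def Q_def)
  qed
  have k_square: "(cmod (k x))\<^sup>2 = (cmod (1 - cnj (v$1) * v$2))\<^sup>2 * (cmod (cinner E (P x) (Q x)))\<^sup>2" for x
    using cmod_one_minus_cnj_commute[of "v$1" "v$2"]
    by (simp add: k_def norm_mult power_mult_distrib mult.commute)
  have AB: "0 \<le> A x" "0 \<le> B x" for x
    using lt by (auto simp: A_def B_def power_le_one)
  have "N v \<le> 1 \<longleftrightarrow> (\<forall>x\<in>carrier E. hnorm E (\<pi> v x) \<le> hnorm E x)"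
    using operator_norm_le_iff[OF bd, of 1 v] rep by (simp add: unital_isometric_representation_def)
  also have "\<dots> \<longleftrightarrow> (\<forall>x\<in>carrier E. 0 \<le> A x + B x + 2 * Re (k x))"
    using cl hnorm_nonneg by (intro ball_cong) (auto simp flip: defect)
  also have "\<dots> \<longleftrightarrow> (\<forall>x\<in>carrier E. \<forall>s t. 0 \<le> A x * (cmod s)\<^sup>2 + B x * (cmod t)\<^sup>2 + 2 * Re (k x * s * cnj t))"
  proof (intro iffI ballI allI)
    fix x s t
    assume "\<forall>x\<in>carrier E. 0 \<le> A x + B x + 2 * Re (k x)" and x: "x \<in> carrier E"
    then have "0 \<le> A (\<pi> (vector [s, t]) x) + B (\<pi> (vector [s, t]) x) + 2 * Re (k (\<pi> (vector [s, t]) x))"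
      using cl by blast
    then show "0 \<le> A x * (cmod s)\<^sup>2 + B x * (cmod t)\<^sup>2 + 2 * Re (k x * s * cnj t)"
      by (simp only: scaled[OF x] vector_2)
  next
    fix x
    assume "\<forall>x\<in>carrier E. \<forall>s t. 0 \<le> A x * (cmod s)\<^sup>2 + B x * (cmod t)\<^sup>2 + 2 * Re (k x * s * cnj t)"
      and "x \<in> carrier E"
    then have "0 \<le> A x * (cmod 1)\<^sup>2 + B x * (cmod 1)\<^sup>2 + 2 * Re (k x * 1 * cnj 1)" by blast
    then show "0 \<le> A x + B x + 2 * Re (k x)" by simp
  qed
  also have "\<dots> \<longleftrightarrow> (\<forall>x\<in>carrier E. (cmod (k x))\<^sup>2 \<le> A x * B x)"
    by (simp only: binary_hermitian_form_nonneg_iff[OF AB])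
  finally show ?thesis by (simp add: k_square A_def B_def P_def Q_def mult_ac)
qed

text \<open>By \<open>pseudohyperbolic_identity\<close>, dividing the condition of \<open>representation_contraction_iff\<close> by
\<open>|1 - cnj v\<^sub>1 v\<^sub>2|\<^sup>2\<close> leaves \<open>1 - \<rho>\<^sup>2\<close> as the only trace of \<open>v\<close>. It is the
same condition as for \<open>(0, \<rho>)\<close>.\<close>

lemma representation_unit_ball:
  fixes \<pi> :: "complex^2 \<Rightarrow> 'a \<Rightarrow> 'a"
  assumes N: "banach_algebra_norm N" and rep: "unital_isometric_representation N E \<pi>"
  shows "unit_ball N = pseudohyperbolic_pairs (1 / N (axis 2 1))" and "1 / N (axis 2 1) \<in> {0<..1}"
proof -
  have "N v \<le> 1 \<longleftrightarrow> pseudohyperbolic (v$1) (v$2) * N (axis 2 1) \<le> 1"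
    if lt: "cmod (v$1) < 1" "cmod (v$2) < 1" for v
  proof -
    define \<rho> where "\<rho> = pseudohyperbolic (v$1) (v$2)"
    define D where "D = (cmod (1 - cnj (v$1) * v$2))\<^sup>2"
    define d where "d = (1 - (cmod (v$1))\<^sup>2) * (1 - (cmod (v$2))\<^sup>2)"
    have D: "D > 0" using one_minus_cnj_nonzero[of "v$1" "v$2"] lt by (auto simp: D_def)
    have "d > 0" using lt by (simp add: d_def abs_square_less_1)
    have "\<rho> \<ge> 0" by (simp add: \<rho>_def pseudohyperbolic_def)
    have \<rho>2: "1 - \<rho>\<^sup>2 = d / D"
      using D pseudohyperbolic_identity[of "v$1" "v$2"]
      by (simp add: \<rho>_def pseudohyperbolic_def D_def d_def power_divide field_simps)
    then have "\<rho>\<^sup>2 < 1" using D \<open>d > 0\<close> by (metis diff_gt_0_iff_gt divide_pos_pos)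
    then have "\<rho> < 1" using \<open>\<rho> \<ge> 0\<close> by (simp add: abs_square_less_1)
    have "N v \<le> 1 \<longleftrightarrow> N (axis 2 (of_real \<rho>)) \<le> 1"
    proof -
      have "D * g \<le> d * h \<longleftrightarrow> g \<le> (1 - \<rho>\<^sup>2) * h" for g h :: real
        using D by (simp add: \<rho>2 field_simps)
      then show ?thesis
        using representation_contraction_iff[OF rep lt]
          representation_contraction_iff[OF rep, of "axis 2 (of_real \<rho>)"] \<open>\<rho> < 1\<close> \<open>\<rho> \<ge> 0\<close>
        by (simp add: axis_def flip: D_def d_def)
    qed
    also have "N (axis 2 (of_real \<rho>)) = \<rho> * N (axis 2 1)"
      using N \<open>\<rho> \<ge> 0\<close> by (subst axis_scale) (simp add: banach_algebra_norm_def complex_norm_def)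
    finally show ?thesis by (simp add: \<rho>_def)
  qed
  from unit_ball_eq_pseudohyperbolic_pairs[OF N this]
  show "unit_ball N = pseudohyperbolic_pairs (1 / N (axis 2 1))" and "1 / N (axis 2 1) \<in> {0<..1}" by blast+
qed

end

section \<open>A two-dimensional model for each radius\<close>

definition cscale :: "complex \<Rightarrow> complex \<times> complex \<Rightarrow> complex \<times> complex" where
  "cscale c u = (c * fst u, c * snd u)"

text \<open>The upper triangular matrix with diagonal \<open>v\<^sub>1, v\<^sub>2\<close> that has the fixed eigenvectors
\<open>(1, 0)\<close> and \<open>(s, 1)\<close>, for all \<open>v\<close>. Hence these matrices multiply coordinatewise in
\<open>v\<close>. The larger \<open>s\<close>, the smaller the angle between the eigenvectors.\<close>

definition triangular :: "real \<Rightarrow> complex^2 \<Rightarrow> complex \<times> complex \<Rightarrow> complex \<times> complex" where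
  "triangular s v u = (v$1 * fst u + of_real s * (v$2 - v$1) * snd u, v$2 * snd u)"

lemma norm_cscale: "norm (cscale c u) = cmod c * norm u"
  by (simp add: cscale_def norm_prod_def norm_mult power_mult_distrib real_sqrt_mult flip: distrib_left)

lemma bounded_linear_triangular: "bounded_linear (triangular s v)"
  unfolding triangular_def
  by (intro bounded_linear_Pair bounded_linear_add bounded_linear_const_mult
      bounded_linear_fst bounded_linear_snd)

lemma triangular_add: "triangular s (v + w) u = triangular s v u + triangular s w u"
  by (simp add: triangular_def algebra_simps)

lemma triangular_scale: "triangular s (c *s v) u = cscale c (triangular s v u)"
  by (simp add: triangular_def cscale_def algebra_simps)

lemma triangular_mult: "triangular s (v * w) u = triangular s v (triangular s w u)"
  by (simp add: triangular_def algebra_simps)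

lemma triangular_one: "triangular s 1 u = u"
  by (simp add: triangular_def)

lemma banach_algebra_norm_onorm_triangular: "banach_algebra_norm (\<lambda>v. onorm (triangular s v))"
  unfolding banach_algebra_norm_def complex_norm_def
proof (intro conjI allI)
  note bl = bounded_linear_triangular[of s]
  fix v w :: "complex^2" and c :: complex
  show "0 \<le> onorm (triangular s v)" by (rule onorm_pos_le[OF bl])
  show "onorm (triangular s v) = 0 \<longleftrightarrow> v = 0"
  proof
    assume "onorm (triangular s v) = 0"
    then have "triangular s v u = 0" for u using onorm_eq_0[OF bl, of v] by blast
    from this[of "(1, 0)"] this[of "(0, 1)"] show "v = 0"
      by (simp add: triangular_def vec_eq_iff forall_2 zero_prod_def)
  qed (simp add: onorm_eq_0[OF bl], simp add: triangular_def zero_prod_def)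
  have scale: "onorm (triangular s (c *s v)) \<le> cmod c * onorm (triangular s v)" for c v
  proof (rule onorm_le)
    fix u show "norm (triangular s (c *s v) u) \<le> cmod c * onorm (triangular s v) * norm u"
      using mult_left_mono[OF onorm[OF bl, of v u], of "cmod c"]
      by (simp add: triangular_scale norm_cscale mult.assoc)
  qed
  show "onorm (triangular s (c *s v)) = cmod c * onorm (triangular s v)"
  proof (cases "c = 0")
    case True
    then show ?thesis
      using scale[of 0 v] onorm_pos_le[OF bl, of "0 *s v"] by simp
  next
    case False
    then have "inverse c *s (c *s v) = v" by (simp add: vec_eq_iff)
    then have "onorm (triangular s v) \<le> inverse (cmod c) * onorm (triangular s (c *s v))"
      using scale[of "inverse c" "c *s v"] by (simp add: norm_inverse)
    then show ?thesis using scale[of c v] False by (simp add: field_simps)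
  qed
  show "onorm (triangular s (v + w)) \<le> onorm (triangular s v) + onorm (triangular s w)"
    using onorm_triangle[OF bl bl, of v w] by (simp add: triangular_add[abs_def])
  show "onorm (triangular s (v * w)) \<le> onorm (triangular s v) * onorm (triangular s w)"
    using onorm_compose[OF bl bl, of v w] by (simp add: triangular_mult[abs_def] o_def)
next
  have "triangular s 1 = (\<lambda>u. u)" by (simp add: fun_eq_iff triangular_one)
  then show "onorm (triangular s 1) = 1" by (simp add: onorm_id)
qed

lemma onorm_triangular_axis: "onorm (triangular s (axis 2 1)) = sqrt (s\<^sup>2 + 1)"
proof (rule antisym)
  have eq: "norm (triangular s (axis 2 1) u) = sqrt (s\<^sup>2 + 1) * cmod (snd u)" for u
  proof -
    have "norm (triangular s (axis 2 1) u) = sqrt ((s\<^sup>2 + 1) * (cmod (snd u))\<^sup>2)"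
      by (simp add: triangular_def axis_def norm_Pair norm_mult power_mult_distrib distrib_right)
    then show ?thesis by (simp add: real_sqrt_mult)
  qed
  show "onorm (triangular s (axis 2 1)) \<le> sqrt (s\<^sup>2 + 1)"
    unfolding eq using norm_snd_le
    by (intro onorm_le) (auto simp: eq intro!: mult_left_mono)
  show "sqrt (s\<^sup>2 + 1) \<le> onorm (triangular s (axis 2 1))"
    using onorm[OF bounded_linear_triangular, of s "axis 2 1" "(0, 1)"] eq[of "(0, 1)"]
    by (simp add: norm_Pair)
qed

text \<open>The Hilbert space of pairs with its vectors renamed along an injection \<open>j\<close>, because the carrier
of a Hilbert space has to consist of functions \<open>'i \<Rightarrow> complex\<close> for a type \<open>'i\<close> that may
have only one element.\<close>

definition coded_plane :: "(complex \<times> complex \<Rightarrow> 'a) \<Rightarrow> 'a inner_product_space" where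
  "coded_plane j = \<lparr>carrier = range j, mult = undefined, one = undefined,
     zero = j 0, add = (\<lambda>x y. j (inv_into UNIV j x + inv_into UNIV j y)),
     smult = (\<lambda>c x. j (cscale c (inv_into UNIV j x))),
     cinner = (\<lambda>x y. fst (inv_into UNIV j x) * cnj (fst (inv_into UNIV j y)) + snd (inv_into UNIV j x) * cnj (snd (inv_into UNIV j y)))\<rparr>"

lemma coded_plane_simps:
  "carrier (coded_plane j) = range j"
  "zero (coded_plane j) = j 0"
  "add (coded_plane j) x y = j (inv_into UNIV j x + inv_into UNIV j y)"
  "smult (coded_plane j) c x = j (cscale c (inv_into UNIV j x))"
  "cinner (coded_plane j) x y = fst (inv_into UNIV j x) * cnj (fst (inv_into UNIV j y)) + snd (inv_into UNIV j x) * cnj (snd (inv_into UNIV j y))"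
  by (simp_all add: coded_plane_def)

lemma cring_complex_field: "cring complex_field"
proof (rule cringI)
  show "abelian_group complex_field"
    by (rule abelian_groupI) (auto simp: algebra_simps intro: exI[of _ "- x" for x] left_minus)
  show "comm_monoid complex_field"
    by (rule comm_monoidI) (auto simp: algebra_simps)
qed (auto simp: algebra_simps)

lemma module_coded_plane:
  assumes "inj j"
  shows "module complex_field (coded_plane j)"
proof (rule moduleI)
  note [simp] = coded_plane_simps inv_f_f[OF assms]
  show "cring complex_field" by (rule cring_complex_field)
  show "abelian_group (coded_plane j)"
  proof (rule abelian_groupI)
    fix x assume "x \<in> carrier (coded_plane j)"
    then obtain u where "x = j u" by auto
    then show "\<exists>y\<in>carrier (coded_plane j). y \<oplus>\<^bsub>coded_plane j\<^esub> x = \<zero>\<^bsub>coded_plane j\<^esub>"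
      by (intro bexI[of _ "j (- u)"]) simp_all
  qed (auto simp: add_ac)
qed (auto simp: coded_plane_simps inv_f_f[OF assms] cscale_def algebra_simps)

lemma hnorm_coded_plane: "hnorm (coded_plane j) x = norm (inv_into UNIV j x)"
  unfolding hnorm_def coded_plane_simps norm_prod_def cmod_power2 by (simp add: power2_eq_square)

lemma hdist_coded_plane:
  assumes "inj j"
  shows "hdist (coded_plane j) x y = dist (inv_into UNIV j x) (inv_into UNIV j y)"
proof -
  note [simp] = coded_plane_simps inv_f_f[OF assms] inj_eq[OF assms]
  have "\<ominus>\<^bsub>coded_plane j\<^esub> y = j (- inv_into UNIV j y)"
    unfolding a_inv_def m_inv_def
  proof (rule the_equality)
    fix z assume "z \<in> carrier (add_monoid (coded_plane j)) \<and>
      y \<otimes>\<^bsub>add_monoid (coded_plane j)\<^esub> z = \<one>\<^bsub>add_monoid (coded_plane j)\<^esub> \<and>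
      z \<otimes>\<^bsub>add_monoid (coded_plane j)\<^esub> y = \<one>\<^bsub>add_monoid (coded_plane j)\<^esub>"
    then obtain w where w: "z = j w" "inv_into UNIV j y + w = 0" by auto
    then show "z = j (- inv_into UNIV j y)" using minus_unique[of "inv_into UNIV j y" w] by simp
  qed simp
  then have "x \<ominus>\<^bsub>coded_plane j\<^esub> y = j (inv_into UNIV j x - inv_into UNIV j y)"
    by (simp add: a_minus_def)
  then show ?thesis by (simp add: hdist_def hnorm_coded_plane dist_norm)
qed

lemma mcomplete_coded_plane:
  assumes "inj j"
  shows "Metric_space.mcomplete (range j) (hdist (coded_plane j))"
proof -
  note [simp] = hdist_coded_plane[OF assms] inv_f_f[OF assms]
  interpret Metric_space "range j" "hdist (coded_plane j)"
    by unfold_locales (auto simp: dist_commute dist_triangle)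
  show ?thesis
    unfolding mcomplete_def
  proof (intro allI impI)
    fix \<sigma> assume \<sigma>: "MCauchy \<sigma>"
    then have "Cauchy (\<lambda>n. inv_into UNIV j (\<sigma> n))"
      unfolding MCauchy_def Cauchy_def by simp
    then obtain l where l: "(\<lambda>n. inv_into UNIV j (\<sigma> n)) \<longlonglongrightarrow> l"
      using Cauchy_convergent convergent_def by blast
    have "limitin mtopology \<sigma> (j l) sequentially"
      unfolding limit_metric_sequentially
      using \<sigma> l by (auto simp: MCauchy_def lim_sequentially image_subset_iff)
    then show "\<exists>x. limitin mtopology \<sigma> x sequentially" by blast
  qed
qed

lemma complex_hilbert_space_coded_plane:
  assumes "inj j"
  shows "complex_hilbert_space (coded_plane j)"
proof (intro complex_hilbert_space.intro complex_hilbert_space_axioms.intro)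
  note [simp] = coded_plane_simps inv_f_f[OF assms]
  show "module complex_field (coded_plane j)" by (rule module_coded_plane[OF assms])
  show "Metric_space.mcomplete (carrier (coded_plane j)) (hdist (coded_plane j))"
    using mcomplete_coded_plane[OF assms] by simp
  show "0 < Re (cinner (coded_plane j) x x)"
    if x: "x \<in> carrier (coded_plane j)" "x \<noteq> \<zero>\<^bsub>coded_plane j\<^esub>" for x
  proof -
    from x(1) obtain u where "x = j u" unfolding coded_plane_simps by blast
    then have u: "x = j u" "u \<noteq> 0" using x(2) by auto
    have "sqrt (Re (cinner (coded_plane j) x x)) = norm u"
      using hnorm_coded_plane[of j x] u by (simp only: hnorm_def inv_f_f[OF assms])
    then show ?thesis using u by (metis real_sqrt_gt_0_iff zero_less_norm_iff)
  qed
qed (auto simp: coded_plane_simps inv_f_f[OF assms] cscale_def algebra_simps)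

text \<open>Under the renaming the two notions of operator norm agree: both are least among the nonnegative
bounds for \<open>\<parallel>T x\<parallel> \<le> K \<parallel>x\<parallel>\<close>.\<close>

lemma triangular_representation:
  assumes j: "inj j"
  shows "unital_isometric_representation (\<lambda>v. onorm (triangular s v)) (coded_plane j)
    (\<lambda>v x. j (triangular s v (inv_into UNIV j x)))"
proof -
  interpret complex_hilbert_space "coded_plane j"
    by (rule complex_hilbert_space_coded_plane[OF j])
  note [simp] = coded_plane_simps inv_f_f[OF j]
  define \<pi> where "\<pi> = (\<lambda>v x. j (triangular s v (inv_into UNIV j x)))"
  note bl = bounded_linear_triangular[of s]
  have bd: "bounded_operator (coded_plane j) (\<pi> v)" for v
    unfolding bounded_operator_def
  proof (intro conjI exI[of _ "onorm (triangular s v)"] ballI allI)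
    show "hnorm (coded_plane j) (\<pi> v x) \<le> onorm (triangular s v) * hnorm (coded_plane j) x" for x
      using onorm[OF bl] by (simp add: \<pi>_def hnorm_coded_plane)
  qed (auto simp: \<pi>_def linear_add[OF bounded_linear.linear[OF bl]],
      simp add: triangular_def cscale_def algebra_simps)
  have norm: "operator_norm (coded_plane j) (\<pi> v) = onorm (triangular s v)" for v
  proof (rule antisym)
    show "operator_norm (coded_plane j) (\<pi> v) \<le> onorm (triangular s v)"
      unfolding operator_norm_le_iff[OF bd onorm_pos_le[OF bl]]
      using onorm[OF bl] by (simp add: \<pi>_def hnorm_coded_plane)
    have "hnorm (coded_plane j) (\<pi> v (j u)) \<le> operator_norm (coded_plane j) (\<pi> v) * hnorm (coded_plane j) (j u)" for u
      by (rule operator_norm_le_iff[OF bd operator_norm_nonneg[OF bd], THEN iffD1, OF order_refl, rule_format])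
         simp
    then show "onorm (triangular s v) \<le> operator_norm (coded_plane j) (\<pi> v)"
      by (intro onorm_le) (simp add: \<pi>_def hnorm_coded_plane)
  qed
  have "unital_isometric_representation (\<lambda>v. onorm (triangular s v)) (coded_plane j) \<pi>"
    unfolding unital_isometric_representation_def
    using bd norm by (auto simp: \<pi>_def triangular_add triangular_scale triangular_mult triangular_one)
  then show ?thesis by (simp add: \<pi>_def)
qed

text \<open>There are as many pairs of complex numbers as complex numbers, and those embed as constant
functions.\<close>

lemma ex_inj_complex_pairs: "\<exists>j :: complex \<times> complex \<Rightarrow> 'i \<Rightarrow> complex. inj j"
proof -
  include cardinal_syntax
  have "infinite (UNIV :: complex set)" by (rule infinite_UNIV_char_0)
  then have "|(UNIV :: complex set) \<times> (UNIV :: complex set)| =o |UNIV :: complex set|"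
    by (rule card_of_Times_same_infinite)
  then obtain f :: "complex \<times> complex \<Rightarrow> complex" where "bij_betw f (UNIV \<times> UNIV) UNIV"
    by (auto simp flip: card_of_ordIso)
  then have f: "inj f" by (simp add: bij_betw_def)
  have "inj (\<lambda>p (_ :: 'i). f p)"
  proof (rule injI)
    fix p q assume "(\<lambda>_ :: 'i. f p) = (\<lambda>_. f q)"
    then have "f p = f q" by (rule fun_cong)
    then show "p = q" by (rule injD[OF f])
  qed
  then show ?thesis by blast
qed

text \<open>The idempotent \<open>q\<close> has norm \<open>sqrt (s\<^sup>2 + 1)\<close> in the triangular model, which is \<open>1 / r\<close> for
the \<open>s\<close> chosen below; the shape of the ball follows from \<open>representation_unit_ball\<close>.\<close>

theorem O_balls_eq: "O_balls TYPE('i) = pseudohyperbolic_pairs ` {0<..1}"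
proof (intro equalityI subsetI)
  fix S :: "(complex^2) set" assume "S \<in> O_balls TYPE('i)"
  then obtain N and E :: "('i \<Rightarrow> complex) inner_product_space" and \<pi>
    where "S = unit_ball N" "banach_algebra_norm N" "complex_hilbert_space E"
      "unital_isometric_representation N E \<pi>"
    unfolding O_balls_def by blast
  then show "S \<in> pseudohyperbolic_pairs ` {0<..1}"
    using complex_hilbert_space.representation_unit_ball[of E N \<pi>] by blast
next
  fix S :: "(complex^2) set" assume "S \<in> pseudohyperbolic_pairs ` {0<..1}"
  then obtain r where r: "0 < r" "r \<le> 1" "S = pseudohyperbolic_pairs r" by auto
  define s where "s = sqrt (1 / r\<^sup>2 - 1)"
  define N where "N = (\<lambda>v. onorm (triangular s v))"
  obtain j :: "complex \<times> complex \<Rightarrow> 'i \<Rightarrow> complex" where j: "inj j" using ex_inj_complex_pairs by blast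
  interpret complex_hilbert_space "coded_plane j"
    by (rule complex_hilbert_space_coded_plane[OF j])
  have N: "banach_algebra_norm N"
    unfolding N_def by (rule banach_algebra_norm_onorm_triangular)
  obtain \<pi> where rep: "unital_isometric_representation N (coded_plane j) \<pi>"
    unfolding N_def using triangular_representation[OF j] by blast
  have "r\<^sup>2 \<le> 1" using r by (simp add: power_le_one)
  then have "s\<^sup>2 + 1 = 1 / r\<^sup>2" using r by (simp add: s_def)
  then have "N (axis 2 1) = 1 / r" using r
    by (simp add: N_def onorm_triangular_axis real_sqrt_divide)
  then have "unit_ball N = S" using representation_unit_ball(1)[OF N rep] r by simp
  then show "S \<in> O_balls TYPE('i)"
    unfolding O_balls_def using N rep complex_hilbert_space_axioms by blast
qed

section \<open>The multivariable inequality\<close>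

lemma mpoly_eval_vec_component:
  fixes a :: "nat \<Rightarrow> complex^'k"
  shows "mpoly_eval vec p a $ l = mpoly_eval (\<lambda>c. c) p (\<lambda>i. a i $ l)"
proof -
  have pow: "(x ^ n) $ l = (x $ l) ^ n" for x :: "complex^'k" and n by (induction n) auto
  have prod: "(\<Prod>i\<in>I. f i) $ l = (\<Prod>i\<in>I. f i $ l)" for f :: "nat \<Rightarrow> complex^'k" and I
    by (induction I rule: infinite_finite_induct) auto
  show ?thesis by (simp add: mpoly_eval_def prod pow)
qed

lemma mpoly_eval_cong:
  assumes "mpoly_in n p" "\<And>i. i < n \<Longrightarrow> y i = z i"
  shows "mpoly_eval h p y = mpoly_eval h p z"
  using assms unfolding mpoly_eval_def mpoly_in_def
  by (intro sum.cong prod.cong refl arg_cong2[of _ _ _ _ "(*)"]) (metis subsetD lessThan_iff)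

lemma mpoly_eval_le_SUP:
  assumes p: "mpoly_in n p" and z: "\<forall>i<n. cmod (z i) \<le> 1"
  shows "cmod (mpoly_eval (\<lambda>c. c) p z)
    \<le> (SUP z\<in>{z. \<forall>i<n. cmod (z i) \<le> 1}. cmod (mpoly_eval (\<lambda>c. c) p z))"
proof (rule cSUP_upper)
  show "bdd_above ((\<lambda>z. cmod (mpoly_eval (\<lambda>c. c) p z)) ` {z. \<forall>i<n. cmod (z i) \<le> 1})"
  proof (rule bdd_aboveI2)
    fix z :: "nat \<Rightarrow> complex" assume z: "z \<in> {z. \<forall>i<n. cmod (z i) \<le> 1}"
    show "cmod (mpoly_eval (\<lambda>c. c) p z) \<le> (\<Sum>m\<in>Poly_Mapping.keys p. cmod (Poly_Mapping.lookup p m))"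
      unfolding mpoly_eval_def
    proof (rule sum_norm_le)
      fix m assume m: "m \<in> Poly_Mapping.keys p"
      have "(\<Prod>i\<in>Poly_Mapping.keys m. cmod (z i) ^ Poly_Mapping.lookup m i) \<le> 1"
        using z m p by (intro prod_le_1) (auto simp: mpoly_in_def intro!: power_le_one)
      then show "cmod (Poly_Mapping.lookup p m * (\<Prod>i\<in>Poly_Mapping.keys m. z i ^ Poly_Mapping.lookup m i))
          \<le> cmod (Poly_Mapping.lookup p m)"
        by (simp add: norm_mult norm_power mult_left_le flip: prod_norm)
    qed
  qed
qed (use z in simp)

lemma disk_algebra_mpoly_eval:
  assumes "mpoly_in n p" "\<And>i. i < n \<Longrightarrow> f i \<in> disk_algebra"
  shows "(\<lambda>z. mpoly_eval (\<lambda>c. c) p (\<lambda>i. f i z)) \<in> disk_algebra"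
  using assms unfolding mpoly_eval_def mpoly_in_def disk_algebra_def
  by (auto intro!: continuous_intros holomorphic_intros)

text \<open>Contractive functions \<open>f\<^sub>i\<close> with the values of \<open>a\<^sub>i\<close> at \<open>0\<close> and \<open>r\<close> exist for
\<open>r < 1\<close>, and Schwarz--Pick for \<open>p(f\<^sub>1, \<dots>, f\<^sub>n)\<close> gives the claim. For \<open>r = 1\<close> the
ball is the closed bidisc and it suffices to bound the coordinates.\<close>

lemma multi_von_neumann_pseudohyperbolic_pairs:
  fixes N :: "complex^2 \<Rightarrow> real"
  assumes N: "banach_algebra_norm N" and ball: "unit_ball N = pseudohyperbolic_pairs r" and r: "0 < r" "r \<le> 1"
  shows "multi_von_neumann N"
  unfolding multi_von_neumann_def
proof (intro allI impI)
  fix n and a :: "nat \<Rightarrow> complex^2" and p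
  assume "(\<forall>i<n. N (a i) \<le> 1) \<and> mpoly_in n p"
  then have a: "\<And>i. i < n \<Longrightarrow> a i \<in> pseudohyperbolic_pairs r" and p: "mpoly_in n p"
    using ball by (auto simp: unit_ball_def)
  let ?q = "mpoly_eval (\<lambda>c. c) p"
  let ?M = "SUP z\<in>{z. \<forall>i<n. cmod (z i) \<le> 1}. cmod (?q z)"
  have M: "cmod (?q z) \<le> ?M" if "\<forall>i<n. cmod (z i) \<le> 1" for z
    by (rule mpoly_eval_le_SUP[OF p that])
  \<comment> \<open>A bound slightly larger than the supremum avoids dividing by \<open>0\<close>.\<close>
  have "N (mpoly_eval vec p a) \<le> K" if K: "?M < K" for K
  proof -
    have "0 \<le> cmod (?q (\<lambda>_. 0))" by (rule norm_ge_zero)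
    also have "\<dots> \<le> ?M" by (rule M) simp
    finally have "0 < K" using K by (rule le_less_trans)
    have le1: "cmod (?q z / of_real K) \<le> 1" if "\<forall>i<n. cmod (z i) \<le> 1" for z
      using M[OF that] K \<open>0 < K\<close> by (simp add: norm_divide)
    define w where "w = of_real (1 / K) *s mpoly_eval vec p a"
    have w: "w $ l = ?q (\<lambda>i. a i $ l) / of_real K" for l
      by (simp add: w_def mpoly_eval_vec_component)
    have al: "\<forall>i<n. cmod (a i $ l) \<le> 1" for l
      using a exhaust_2[of l] by (auto simp: pseudohyperbolic_pairs_def)
    have wle: "cmod (w $ l) \<le> 1" for l unfolding w by (rule le1[OF al])
    have "cmod (w$1 - w$2) \<le> r * cmod (1 - cnj (w$1) * w$2)"
    proof (cases "r = 1")
      case True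
      then show ?thesis using cmod_diff_le_disc[OF wle wle] by simp
    next
      case False
      define \<alpha> :: "2 \<Rightarrow> complex" where "\<alpha> = (\<lambda>l. if l = 1 then 0 else of_real r)"
      have \<alpha>: "\<alpha> 1 = 0" "\<alpha> 2 = of_real r" by (auto simp: \<alpha>_def)
      have \<rho>: "pseudohyperbolic (\<alpha> 1) (\<alpha> 2) = r" using r by (simp add: \<alpha> pseudohyperbolic_def)
      have "\<exists>f. f \<in> disk_algebra \<and> (\<forall>z. cmod z \<le> 1 \<longrightarrow> cmod (f z) \<le> 1) \<and> (\<forall>l. f (\<alpha> l) = a i $ l)"
        if "i < n" for i
      proof -
        have "\<alpha> 1 \<noteq> \<alpha> 2" "cmod (\<alpha> 1) < 1" "cmod (\<alpha> 2) < 1" using False r by (auto simp: \<alpha>)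
        then show ?thesis
          using pseudohyperbolic_pairs_interpolation[of \<alpha> "a i"] a[OF that] \<rho> by metis
      qed
      then obtain f where f: "\<And>i. i < n \<Longrightarrow> f i \<in> disk_algebra"
        "\<And>i z. i < n \<Longrightarrow> cmod z \<le> 1 \<Longrightarrow> cmod (f i z) \<le> 1"
        "\<And>i l. i < n \<Longrightarrow> f i (\<alpha> l) = a i $ l"
        by metis
      define F where "F = (\<lambda>z. of_real (1 / K) * ?q (\<lambda>i. f i z))"
      have F: "F \<in> disk_algebra"
        unfolding F_def by (intro disk_algebra_scale disk_algebra_mpoly_eval[OF p] f(1))
      have F1: "cmod (F z) \<le> 1" if "cmod z \<le> 1" for z
        using le1[of "\<lambda>i. f i z"] f(2) that by (simp add: F_def)
      have "?q (\<lambda>i. f i (\<alpha> l)) = ?q (\<lambda>i. a i $ l)" for l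
        by (rule mpoly_eval_cong[OF p]) (rule f(3))
      then have "F (\<alpha> l) = w $ l" for l by (simp add: F_def w)
      then have "F 0 = w $ 1" "F (of_real r) = w $ 2" using \<alpha> by metis+
      then show ?thesis using Schwarz_Pick[OF F F1, of 0 "of_real r"] r by simp
    qed
    then have "N w \<le> 1"
      using ball wle by (auto simp: unit_ball_def pseudohyperbolic_pairs_def set_eq_iff)
    moreover have "N w = N (mpoly_eval vec p a) / K"
      using N \<open>0 < K\<close> by (simp add: w_def banach_algebra_norm_def complex_norm_def norm_divide)
    ultimately show ?thesis using \<open>0 < K\<close> by (simp add: field_simps)
  qed
  then show "N (mpoly_eval vec p a) \<le> ?M" by (rule dense_ge)
qed


section \<open>From several variables to one\<close>

lemma one_variable_monomial:
  fixes m :: "nat \<Rightarrow>\<^sub>0 nat"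
  assumes "Poly_Mapping.keys m \<subseteq> {0}"
  shows "m = Poly_Mapping.single 0 (Poly_Mapping.lookup m 0)"
proof (rule poly_mapping_eqI)
  show "Poly_Mapping.lookup m i = Poly_Mapping.lookup (Poly_Mapping.single 0 (Poly_Mapping.lookup m 0)) i" for i
    using assms by (cases "i = 0") (auto simp: lookup_single when_def simp flip: not_in_keys_iff_lookup_eq_zero)
qed

lemma one_variable_support:
  fixes p :: "complex poly"
  defines "c \<equiv> \<lambda>m :: nat \<Rightarrow>\<^sub>0 nat. if Poly_Mapping.keys m \<subseteq> {0} then coeff p (Poly_Mapping.lookup m 0) else 0"
  shows "{m. c m \<noteq> 0} \<subseteq> Poly_Mapping.single 0 ` {..degree p}"
proof
  fix m assume "m \<in> {m. c m \<noteq> 0}"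
  then have m: "Poly_Mapping.keys m \<subseteq> {0}" "coeff p (Poly_Mapping.lookup m 0) \<noteq> 0"
    by (auto simp: c_def split: if_splits)
  have "m = Poly_Mapping.single 0 (Poly_Mapping.lookup m 0)" by (rule one_variable_monomial[OF m(1)])
  moreover have "Poly_Mapping.lookup m 0 \<in> {..degree p}" using m(2) by (simp add: le_degree)
  ultimately show "m \<in> Poly_Mapping.single 0 ` {..degree p}" by (rule image_eqI)
qed

lift_definition mpoly_of_poly :: "complex poly \<Rightarrow> mpoly" is
  "\<lambda>p m. if Poly_Mapping.keys m \<subseteq> {0} then coeff p (Poly_Mapping.lookup m 0) else 0"
  by (rule finite_subset[OF one_variable_support]) simp

lemma keys_mpoly_of_poly:
  "Poly_Mapping.keys (mpoly_of_poly p) \<subseteq> Poly_Mapping.single 0 ` {..degree p}"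
  using one_variable_support[of p] by transfer

lemma mpoly_in_mpoly_of_poly: "mpoly_in 1 (mpoly_of_poly p)"
  unfolding mpoly_in_def
proof
  fix m assume "m \<in> Poly_Mapping.keys (mpoly_of_poly p)"
  then obtain j where "m = Poly_Mapping.single 0 j" using keys_mpoly_of_poly by blast
  then show "Poly_Mapping.keys m \<subseteq> {..<1}" by simp
qed

lemma mpoly_eval_mpoly_of_poly: "mpoly_eval (\<lambda>c. c) (mpoly_of_poly p) z = poly p (z 0)"
proof -
  let ?s = "Poly_Mapping.single (0 :: nat) :: nat \<Rightarrow> (nat \<Rightarrow>\<^sub>0 nat)"
  have lookup: "Poly_Mapping.lookup (mpoly_of_poly p) (?s j) = coeff p j" for j
    by (simp add: mpoly_of_poly.rep_eq)
  have monomial: "(\<Prod>i\<in>Poly_Mapping.keys (?s j). z i ^ Poly_Mapping.lookup (?s j) i) = z 0 ^ j" for j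
    by (cases "j = 0") auto
  have "mpoly_eval (\<lambda>c. c) (mpoly_of_poly p) z =
      (\<Sum>m\<in>?s ` {..degree p}. Poly_Mapping.lookup (mpoly_of_poly p) m *
        (\<Prod>i\<in>Poly_Mapping.keys m. z i ^ Poly_Mapping.lookup m i))"
    unfolding mpoly_eval_def by (rule sum.mono_neutral_left) (use keys_mpoly_of_poly in \<open>auto simp: in_keys_iff\<close>)
  also have "\<dots> = (\<Sum>j\<le>degree p. coeff p j * z 0 ^ j)"
  proof (subst sum.reindex)
    show "inj_on ?s {..degree p}"
      by (rule inj_onI) (metis lookup_single_eq)
  qed (simp add: lookup monomial del: keys_single)
  finally show ?thesis by (simp add: poly_altdef)
qed

lemma multi_von_neumann_imp_von_neumann:
  assumes "multi_von_neumann N"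
  shows "von_neumann N"
  unfolding von_neumann_def
proof (intro allI impI)
  fix a and p :: "complex poly" assume a: "N a \<le> 1"
  let ?q = "mpoly_of_poly p"
  have "mpoly_eval vec ?q (\<lambda>_. a) = poly (map_poly vec p) a"
    by (simp add: vec_eq_iff mpoly_eval_vec_component mpoly_eval_mpoly_of_poly poly_map_poly_vec)
  moreover have "(\<lambda>z. cmod (mpoly_eval (\<lambda>c. c) ?q z)) ` {z. \<forall>i<1. cmod (z i) \<le> 1}
      = (\<lambda>z. cmod (poly p z)) ` {z. cmod z \<le> 1}"
    by (auto simp: mpoly_eval_mpoly_of_poly image_iff)
  moreover have "N (mpoly_eval vec ?q (\<lambda>_. a))
      \<le> (SUP z\<in>{z. \<forall>i<1. cmod (z i) \<le> 1}. cmod (mpoly_eval (\<lambda>c. c) ?q z))"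
    by (rule assms[unfolded multi_von_neumann_def, THEN spec, THEN spec, THEN spec, THEN mp])
       (simp add: a mpoly_in_mpoly_of_poly[simplified])
  ultimately show "N (poly (map_poly vec p) a) \<le> (SUP z\<in>{z. cmod z \<le> 1}. cmod (poly p z))"
    by simp
qed

text \<open>A cycle of inclusions. The norm with ball \<open>D\<^sub>r\<close> comes from an operator algebra.\<close>

theorem H_balls_eq: "H_balls = pseudohyperbolic_pairs ` {0<..1}"
  and V_balls_eq: "V_balls = pseudohyperbolic_pairs ` {0<..1}"
proof -
  have "H_balls \<subseteq> V_balls"
    using multi_von_neumann_imp_von_neumann unfolding H_balls_def V_balls_def by blast
  moreover have "V_balls \<subseteq> pseudohyperbolic_pairs ` {0<..1}"
    using von_neumann_unit_ball unfolding V_balls_def by blast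
  moreover have "pseudohyperbolic_pairs ` {0<..1} \<subseteq> H_balls"
  proof
    fix S assume S: "S \<in> pseudohyperbolic_pairs ` {0<..1}"
    then have "S \<in> O_balls TYPE(unit)" by (simp add: O_balls_eq)
    then obtain N where N: "S = unit_ball N" "banach_algebra_norm N" by (auto simp: O_balls_def)
    from S obtain r where "S = pseudohyperbolic_pairs r" "0 < r" "r \<le> 1" by auto
    then have "multi_von_neumann N" using multi_von_neumann_pseudohyperbolic_pairs[OF N(2)] N(1) by metis
    then show "S \<in> H_balls" using N unfolding H_balls_def by blast
  qed
  ultimately show "H_balls = pseudohyperbolic_pairs ` {0<..1}" "V_balls = pseudohyperbolic_pairs ` {0<..1}" by blast+
qed


section \<open>A Banach algebra norm violating von Neumann's inequality\<close>

text \<open>The \<open>l\<^sup>1\<close>-norm of the coefficients of \<open>v\<close> in the basis \<open>1\<close>, \<open>q = (0, 1)\<close>. It is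
submultiplicative because \<open>{1, q}\<close> is a semigroup.\<close>

definition l1_semigroup_norm :: "complex^2 \<Rightarrow> real" where
  "l1_semigroup_norm v = cmod (v$1) + cmod (v$2 - v$1)"

lemma banach_algebra_norm_l1_semigroup: "banach_algebra_norm l1_semigroup_norm"
  unfolding banach_algebra_norm_def complex_norm_def
proof (intro conjI allI)
  fix v w :: "complex^2" and c :: complex
  show "0 \<le> l1_semigroup_norm v" by (simp add: l1_semigroup_norm_def)
  show "l1_semigroup_norm v = 0 \<longleftrightarrow> v = 0"
    by (auto simp: l1_semigroup_norm_def vec_eq_iff forall_2 add_nonneg_eq_0_iff)
  show "l1_semigroup_norm (c *s v) = cmod c * l1_semigroup_norm v"
    by (simp add: l1_semigroup_norm_def norm_mult distrib_left flip: right_diff_distrib)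
  have "cmod (v$2 + w$2 - (v$1 + w$1)) \<le> cmod (v$2 - v$1) + cmod (w$2 - w$1)"
    using norm_triangle_ineq[of "v$2 - v$1" "w$2 - w$1"] by (simp add: algebra_simps)
  then show "l1_semigroup_norm (v + w) \<le> l1_semigroup_norm v + l1_semigroup_norm w"
    using norm_triangle_ineq[of "v$1" "w$1"] by (simp add: l1_semigroup_norm_def)
  define x y where "x = v$2 - v$1" and "y = w$2 - w$1"
  have v2: "v$2 = v$1 + x" and w2: "w$2 = w$1 + y" by (simp_all add: x_def y_def)
  have "v$2 * w$2 - v$1 * w$1 = v$1 * y + x * w$1 + x * y"
    unfolding v2 w2 by (simp add: algebra_simps)
  then have "cmod (v$2 * w$2 - v$1 * w$1) \<le> cmod (v$1 * y) + cmod (x * w$1) + cmod (x * y)"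
    using norm_triangle_ineq[of "v$1 * y + x * w$1" "x * y"] norm_triangle_ineq[of "v$1 * y" "x * w$1"]
    by simp
  then show "l1_semigroup_norm (v * w) \<le> l1_semigroup_norm v * l1_semigroup_norm w"
    by (simp add: l1_semigroup_norm_def norm_mult algebra_simps flip: x_def y_def)
next
  show "l1_semigroup_norm 1 = 1" by (simp add: l1_semigroup_norm_def)
qed

text \<open>The idempotent \<open>(0, 1)\<close> forces \<open>r = 1\<close>, so \<open>(1, -1)\<close> would be in the ball; its norm is
\<open>3\<close>.\<close>

lemma unit_ball_l1_semigroup_norm: "unit_ball l1_semigroup_norm \<notin> pseudohyperbolic_pairs ` {0<..1}"
proof
  assume "unit_ball l1_semigroup_norm \<in> pseudohyperbolic_pairs ` {0<..1}"
  then obtain r where r: "r \<le> 1" and eq: "unit_ball l1_semigroup_norm = pseudohyperbolic_pairs r" by auto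
  have "vector [0, 1] \<in> unit_ball l1_semigroup_norm" by (simp add: unit_ball_def l1_semigroup_norm_def)
  then have "r = 1" using r unfolding eq by (simp add: pseudohyperbolic_pairs_def)
  then have "vector [1, -1] \<in> unit_ball l1_semigroup_norm" unfolding eq by (simp add: pseudohyperbolic_pairs_def)
  then show False by (simp add: unit_ball_def l1_semigroup_norm_def)
qed

theorem theorem2p10:
  shows "(P_balls :: (complex^2) set set) = H_balls
    \<and> (H_balls :: (complex^2) set set) = O_balls TYPE('i)
    \<and> (O_balls TYPE('i) :: (complex^2) set set) = V_balls
    \<and> (V_balls :: (complex^2) set set) \<noteq> B_balls"
proof -
  have "unit_ball l1_semigroup_norm \<in> B_balls"
    unfolding B_balls_def using banach_algebra_norm_l1_semigroup by blast
  then have "(V_balls :: (complex^2) set set) \<noteq> B_balls"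
    using unit_ball_l1_semigroup_norm unfolding V_balls_eq by blast
  then show ?thesis
    by (simp add: P_balls_eq H_balls_eq V_balls_eq O_balls_eq)
qed

end
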